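(* Let $\mathcal H$ be a complex Hilbert space and let $0\neq T\in\mathcal B(\mathcal H)$. Then the subspace $\mathbb CT$ has complete hyperreflexivity constant at most $4$, i.e. $\kappa^c_{\mathbb CT}\le 4$.
   Context: For a linear subspace $\mathcal S\subset\mathcal B(\mathcal H)$ and $x\in\mathcal H$, $P_{\mathcal Sx}$ is the orthogonal projection onto $\overline{\mathcal Sx}$, and $\beta_{\mathcal S}(T)=\sup_{\|x\|=1}\|P_{\mathcal Sx}^\perp Tx\|$. $\mathcal S$ is hyperreflexive if there is a constant $C$ with $\operatorname{dist}(T,\mathcal S)\le C\,\beta_{\mathcal S}(T)$ for all $T\in\mathcal B(\mathcal H)$; $\kappa_{\mathcal S}$ denotes the least such constant $C\ge1$. A WOT-closed subspace $\mathcal S$ is completely hyperreflexive if $\mathcal S\,\bar\otimes\,\mathcal B(\mathcal K)\subset\mathcal B(\mathcal H\otimes\mathcal K)$ (the WOT-closure of the spatial tensor product) is hyperreflexive, where $\mathcal K$ is a separable infinite-dimensional Hilbert space; $\kappa^c_{\mathcal S}$ is the hyperreflexivity constant of $\mathcal S\,\bar\otimes\,\mathcal B(\mathcal K)$. *)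

theory Defs
  imports "HOL-Analysis.Analysis"
begin

class complex_vector = real_vector +
  fixes scaleC :: "complex \<Rightarrow> 'a \<Rightarrow> 'a" (infixr "*\<^sub>C" 75)
  assumes scaleC_add_right: "a *\<^sub>C (x + y) = a *\<^sub>C x + a *\<^sub>C y"
    and scaleC_add_left: "(a + b) *\<^sub>C x = a *\<^sub>C x + b *\<^sub>C x"
    and scaleC_scaleC: "a *\<^sub>C b *\<^sub>C x = (a * b) *\<^sub>C x"
    and scaleC_one: "1 *\<^sub>C x = x"
    and scaleR_scaleC: "r *\<^sub>R x = complex_of_real r *\<^sub>C x"

global_interpretation complex_vector:
  vector_space "scaleC :: complex \<Rightarrow> 'a \<Rightarrow> 'a::complex_vector"
  by unfold_locales (simp_all add: scaleC_add_right scaleC_add_left scaleC_scaleC scaleC_one)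

text \<open>The inner product is linear in the first argument. Completeness is inherited from
  \<^class>\<open>banach\<close>.\<close>

class chilbert_space = complex_vector + banach +
  fixes cinner :: "'a \<Rightarrow> 'a \<Rightarrow> complex"
  assumes cinner_commute: "cinner x y = cnj (cinner y x)"
    and cinner_add_left: "cinner (x + y) z = cinner x z + cinner y z"
    and cinner_scaleC_left: "cinner (c *\<^sub>C x) y = c * cinner x y"
    and cinner_self: "cinner x x = complex_of_real ((norm x)\<^sup>2)"

lemma norm_scaleC: "norm (c *\<^sub>C x) = cmod c * norm x" for x :: "'a::chilbert_space"
proof -
  have r: "cinner (c *\<^sub>C x) (c *\<^sub>C x) = c * cnj c * cinner x x"
    by (metis cinner_commute cinner_scaleC_left complex_cnj_mult mult.assoc)
  have "complex_of_real ((norm (c *\<^sub>C x))\<^sup>2) = complex_of_real ((cmod c * norm x)\<^sup>2)"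
    using r unfolding cinner_self complex_norm_square[symmetric]
    by (simp add: power_mult_distrib)
  then have "(norm (c *\<^sub>C x))\<^sup>2 = (cmod c * norm x)\<^sup>2"
    using of_real_eq_iff by blast
  then show ?thesis
    by (simp add: power2_eq_iff_nonneg)
qed

lemma bounded_linear_scaleC_right: "bounded_linear (\<lambda>x::'a::chilbert_space. c *\<^sub>C x)"
  by (rule bounded_linear_intro[where K = "cmod c"])
    (simp_all add: scaleC_add_right scaleR_scaleC scaleC_scaleC norm_scaleC mult.commute)

instantiation blinfun :: (real_normed_vector, chilbert_space) complex_vector
begin

lift_definition scaleC_blinfun :: "complex \<Rightarrow> 'a \<Rightarrow>\<^sub>L 'b \<Rightarrow> 'a \<Rightarrow>\<^sub>L 'b" is "\<lambda>c f x. c *\<^sub>C f x"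
  by (metis bounded_linear_compose bounded_linear_scaleC_right)

instance
  by standard
    (transfer, simp add: scaleC_add_right scaleC_add_left scaleC_scaleC scaleC_one scaleR_scaleC)+

end

text \<open>\<open>'h \<Rightarrow>\<^sub>L 'h\<close> consists of the bounded real-linear maps; \<open>\<B>(H)\<close> is the complex-linear part.
  The operator norm is the same in both settings.\<close>

definition bounded_ops :: "('h::chilbert_space \<Rightarrow>\<^sub>L 'h) set"
  where "bounded_ops = {A. \<forall>c x. blinfun_apply A (c *\<^sub>C x) = c *\<^sub>C blinfun_apply A x}"

text \<open>Weak operator topology on \<open>\<B>(H)\<close>: the coarsest one making all \<open>A \<mapsto> \<langle>A x, y\<rangle>\<close> continuous.
  The topology \<open>euclidean\<close> on a function type is the product topology.\<close>

definition weak_operator_topology :: "('h::chilbert_space \<Rightarrow>\<^sub>L 'h) topology"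
  where "weak_operator_topology =
    pullback_topology bounded_ops (\<lambda>A x y. cinner (blinfun_apply A x) y) euclidean"

definition orth_proj :: "'h::chilbert_space set \<Rightarrow> 'h \<Rightarrow> 'h"
  where "orth_proj M x = (THE p. p \<in> M \<and> (\<forall>m\<in>M. cinner (x - p) m = 0))"

definition orbit_closure :: "('h::chilbert_space \<Rightarrow>\<^sub>L 'h) set \<Rightarrow> 'h \<Rightarrow> 'h set"
  where "orbit_closure S x = closure ((\<lambda>A. blinfun_apply A x) ` S)"

definition hyperreflexivity_beta :: "('h::chilbert_space \<Rightarrow>\<^sub>L 'h) set \<Rightarrow> ('h \<Rightarrow>\<^sub>L 'h) \<Rightarrow> real"
  where "hyperreflexivity_beta S T =
    (SUP x\<in>{x. norm x = 1}.
      norm (blinfun_apply T x - orth_proj (orbit_closure S x) (blinfun_apply T x)))"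

definition hyperreflexivity_bound :: "('h::chilbert_space \<Rightarrow>\<^sub>L 'h) set \<Rightarrow> real \<Rightarrow> bool"
  where "hyperreflexivity_bound S C \<longleftrightarrow>
    (\<forall>T\<in>bounded_ops. infdist T S \<le> C * hyperreflexivity_beta S T)"

definition hyperreflexive :: "('h::chilbert_space \<Rightarrow>\<^sub>L 'h) set \<Rightarrow> bool"
  where "hyperreflexive S \<longleftrightarrow> (\<exists>C. hyperreflexivity_bound S C)"

text \<open>Only meaningful for hyperreflexive \<open>S\<close>; the infimum is then attained.\<close>

definition hyperreflexivity_constant :: "('h::chilbert_space \<Rightarrow>\<^sub>L 'h) set \<Rightarrow> real"
  where "hyperreflexivity_constant S = Inf {C. 1 \<le> C \<and> hyperreflexivity_bound S C}"

text \<open>A Hilbert space \<open>'l\<close> with a map \<open>t x y = x \<otimes> y\<close> is a Hilbert space tensor product of \<open>'h\<close>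
  and \<open>'k\<close>; such a pair is unique up to a unitary that intertwines the maps \<open>t\<close>.\<close>

definition is_hilbert_tensor ::
    "('h::chilbert_space \<Rightarrow> 'k::chilbert_space \<Rightarrow> 'l::chilbert_space) \<Rightarrow> bool"
  where "is_hilbert_tensor t \<longleftrightarrow>
    (\<forall>x x' y. t (x + x') y = t x y + t x' y) \<and>
    (\<forall>x y y'. t x (y + y') = t x y + t x y') \<and>
    (\<forall>c x y. t (c *\<^sub>C x) y = c *\<^sub>C t x y) \<and>
    (\<forall>c x y. t x (c *\<^sub>C y) = c *\<^sub>C t x y) \<and>
    (\<forall>x y x' y'. cinner (t x y) (t x' y') = cinner x x' * cinner y y') \<and>
    closure (complex_vector.span {t x y | x y. True}) = UNIV"

definition op_tensor ::
    "('h::chilbert_space \<Rightarrow> 'k::chilbert_space \<Rightarrow> 'l::chilbert_space)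
      \<Rightarrow> ('h \<Rightarrow>\<^sub>L 'h) \<Rightarrow> ('k \<Rightarrow>\<^sub>L 'k) \<Rightarrow> ('l \<Rightarrow>\<^sub>L 'l)"
  where "op_tensor t A B = (THE C. C \<in> bounded_ops \<and>
    (\<forall>x y. blinfun_apply C (t x y) = t (blinfun_apply A x) (blinfun_apply B y)))"

definition spatial_tensor ::
    "('h::chilbert_space \<Rightarrow> 'k::chilbert_space \<Rightarrow> 'l::chilbert_space)
      \<Rightarrow> ('h \<Rightarrow>\<^sub>L 'h) set \<Rightarrow> ('k \<Rightarrow>\<^sub>L 'k) set \<Rightarrow> ('l \<Rightarrow>\<^sub>L 'l) set"
  where "spatial_tensor t S R =
    closure (complex_vector.span {op_tensor t A B | A B. A \<in> S \<and> B \<in> R})"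

definition wot_tensor ::
    "('h::chilbert_space \<Rightarrow> 'k::chilbert_space \<Rightarrow> 'l::chilbert_space)
      \<Rightarrow> ('h \<Rightarrow>\<^sub>L 'h) set \<Rightarrow> ('k \<Rightarrow>\<^sub>L 'k) set \<Rightarrow> ('l \<Rightarrow>\<^sub>L 'l) set"
  where "wot_tensor t S R = weak_operator_topology closure_of (spatial_tensor t S R)"

text \<open>The following two notions are used when \<open>t\<close> is a Hilbert space tensor product whose second
  factor \<open>'k\<close> is separable and infinite-dimensional; by uniqueness of separable
  infinite-dimensional Hilbert spaces and of \<open>t\<close> they do not depend on these choices.\<close>

definition completely_hyperreflexive ::
    "('h::chilbert_space \<Rightarrow> 'k::chilbert_space \<Rightarrow> 'l::chilbert_space) \<Rightarrow> ('h \<Rightarrow>\<^sub>L 'h) set \<Rightarrow> bool"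
  where "completely_hyperreflexive t S \<longleftrightarrow>
    complex_vector.subspace S \<and> closedin weak_operator_topology S \<and>
    hyperreflexive (wot_tensor t S bounded_ops)"

definition complete_hyperreflexivity_constant ::
    "('h::chilbert_space \<Rightarrow> 'k::chilbert_space \<Rightarrow> 'l::chilbert_space) \<Rightarrow> ('h \<Rightarrow>\<^sub>L 'h) set \<Rightarrow> real"
  where "complete_hyperreflexivity_constant t S =
    hyperreflexivity_constant (wot_tensor t S bounded_ops)"

end

theory Submission
  imports Defs
begin

text \<open>The space \<open>S = \<complex>T \<otimes> \<B>(K)\<close> consists of the operators \<open>T \<otimes> B\<close>. Vectors
  \<open>y = \<Sum> y\<^sub>i \<otimes> f\<^sub>i\<close> and \<open>z = \<Sum> z\<^sub>j \<otimes> f'\<^sub>j\<close> with \<open>\<langle>T y\<^sub>i, z\<^sub>j\<rangle> = 0\<close> for all \<open>i, j\<close> satisfy \<open>z \<bottom> S y\<close>,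
  hence \<open>\<bar>\<langle>A y, z\<rangle>\<bar> \<le> \<beta> \<parallel>y\<parallel> \<parallel>z\<parallel>\<close>. Choose a unit vector \<open>h\<close> with \<open>\<parallel>T h\<parallel>\<close> close to \<open>\<parallel>T\<parallel>\<close>, put
  \<open>g = T h / \<parallel>T h\<parallel>\<^sup>2\<close> and define \<open>B\<close> by \<open>\<langle>B k, k'\<rangle> = \<langle>A (h \<otimes> k), g \<otimes> k'\<rangle>\<close>.
  By a singular value decomposition of the matrix \<open>\<langle>T y\<^sub>i, z\<^sub>j\<rangle>\<close>, arbitrary \<open>y\<close> and \<open>z\<close> in the algebraic
  tensor product have expansions along orthonormal systems for which this matrix is diagonal.
  Averaging the vanishing blocks over all subsets of the index set bounds the off-diagonal part
  of \<open>\<langle>A y, z\<rangle>\<close> by \<open>2 \<beta>\<close>. Each diagonal term is the value of a functional of rank two that annihilates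
  \<open>T\<close>; splitting it into two rank-one annihilators bounds the diagonal part of
  \<open>\<langle>(A - T \<otimes> B) y, z\<rangle>\<close> by \<open>(1 + \<parallel>T\<parallel> / \<parallel>T h\<parallel>) \<beta>\<close>. In total, \<open>\<parallel>A - T \<otimes> B\<parallel> \<le> (3 + \<parallel>T\<parallel> / \<parallel>T h\<parallel>) \<beta>\<close>,
  which tends to \<open>4 \<beta>\<close> as \<open>\<parallel>T h\<parallel> \<rightarrow> \<parallel>T\<parallel>\<close>.\<close>

section \<open>Hilbert space preliminaries\<close>

lemma cinner_zero_left [simp]: "cinner 0 y = 0"
  using cinner_add_left[of 0 0 y] by simp

lemma cinner_zero_right [simp]: "cinner x 0 = 0"
  by (subst cinner_commute) simp

lemma cinner_add_right: "cinner x (y + z) = cinner x y + cinner x z"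
  by (metis cinner_add_left cinner_commute complex_cnj_add)

lemma cinner_scaleC_right: "cinner x (c *\<^sub>C y) = cnj c * cinner x y"
  by (metis cinner_commute cinner_scaleC_left complex_cnj_mult)

lemma cinner_scaleR_left: "cinner (r *\<^sub>R x) y = of_real r * cinner x y"
  by (simp add: scaleR_scaleC cinner_scaleC_left)

lemma cinner_scaleR_right: "cinner x (r *\<^sub>R y) = of_real r * cinner x y"
  by (simp add: scaleR_scaleC cinner_scaleC_right)

lemma cinner_minus_left: "cinner (- x) y = - cinner x y"
  using cinner_add_left[of x "- x" y] by (simp add: eq_neg_iff_add_eq_0 add.commute)

lemma cinner_minus_right: "cinner x (- y) = - cinner x y"
  using cinner_add_right[of x y "- y"] by (simp add: eq_neg_iff_add_eq_0 add.commute)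

lemma cinner_diff_left: "cinner (x - y) z = cinner x z - cinner y z"
  using cinner_add_left[of x "- y" z] by (simp add: cinner_minus_left)

lemma cinner_diff_right: "cinner x (y - z) = cinner x y - cinner x z"
  using cinner_add_right[of x y "- z"] by (simp add: cinner_minus_right)

lemma cinner_sum_left: "cinner (\<Sum>i\<in>I. f i) y = (\<Sum>i\<in>I. cinner (f i) y)"
  by (induction I rule: infinite_finite_induct) (simp_all add: cinner_add_left)

lemma cinner_sum_right: "cinner x (\<Sum>i\<in>I. f i) = (\<Sum>i\<in>I. cinner x (f i))"
  by (induction I rule: infinite_finite_induct) (simp_all add: cinner_add_right)

lemmas cinner_simps = cinner_add_left cinner_add_right cinner_diff_left cinner_diff_right
  cinner_scaleC_left cinner_scaleC_right cinner_minus_left cinner_minus_right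

lemma cinner_self_eq_0: "cinner x x = 0 \<longleftrightarrow> x = 0"
  by (simp add: cinner_self)

lemma norm_add_square:
  "(norm (x + y))\<^sup>2 = (norm x)\<^sup>2 + (norm y)\<^sup>2 + 2 * Re (cinner x y)"
  for x y :: "'a::chilbert_space"
proof -
  have "complex_of_real ((norm (x + y))\<^sup>2) = cinner (x + y) (x + y)"
    by (simp add: cinner_self)
  also have "\<dots> = cinner x x + cinner y y + (cinner x y + cnj (cinner x y))"
    by (simp add: cinner_simps cinner_commute[of y x])
  also have "\<dots> = complex_of_real ((norm x)\<^sup>2 + (norm y)\<^sup>2 + 2 * Re (cinner x y))"
    by (simp add: cinner_self complex_add_cnj)
  finally show ?thesis
    using of_real_eq_iff by blast
qed

lemma norm_diff_square:
  "(norm (x - y))\<^sup>2 = (norm x)\<^sup>2 + (norm y)\<^sup>2 - 2 * Re (cinner x y)"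
  for x y :: "'a::chilbert_space"
  using norm_add_square[of x "- y"] by (simp add: cinner_minus_right)

text \<open>Pythagoras for the component of \<open>x\<close> along \<open>m\<close>. Nonnegativity
  of the left side yields Cauchy-Schwarz; minimality of a distance yields orthogonality.\<close>

lemma norm_diff_component_square:
  fixes x m :: "'a::chilbert_space"
  assumes "m \<noteq> 0"
  defines "c \<equiv> cinner x m / of_real ((norm m)\<^sup>2)"
  shows "(norm (x - c *\<^sub>C m))\<^sup>2 = (norm x)\<^sup>2 - (cmod (cinner x m))\<^sup>2 / (norm m)\<^sup>2"
proof -
  have "cinner x (c *\<^sub>C m) = cinner x m * cnj (cinner x m) / of_real ((norm m)\<^sup>2)"
    by (simp add: c_def cinner_scaleC_right)
  also have "\<dots> = of_real ((cmod (cinner x m))\<^sup>2 / (norm m)\<^sup>2)"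
    by (simp flip: complex_norm_square)
  finally have "Re (cinner x (c *\<^sub>C m)) = (cmod (cinner x m))\<^sup>2 / (norm m)\<^sup>2"
    by (metis Re_complex_of_real)
  moreover have "(norm (c *\<^sub>C m))\<^sup>2 = (cmod (cinner x m))\<^sup>2 / (norm m)\<^sup>2"
    using assms(1)
    by (simp add: norm_scaleC c_def norm_divide norm_power power_mult_distrib power_divide)
       (simp add: power2_eq_square power4_eq_xxxx)
  ultimately show ?thesis
    by (simp add: norm_diff_square)
qed

lemma cinner_Cauchy_Schwarz: "cmod (cinner x y) \<le> norm x * norm y"
  for x y :: "'a::chilbert_space"
proof (cases "y = 0")
  case False
  have "0 \<le> (norm x)\<^sup>2 - (cmod (cinner x y))\<^sup>2 / (norm y)\<^sup>2"
    by (metis norm_diff_component_square[OF False] zero_le_power2)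
  then have "(cmod (cinner x y))\<^sup>2 \<le> (norm x * norm y)\<^sup>2"
    using False by (simp add: field_simps)
  then show ?thesis
    by (rule power2_le_imp_le) simp
qed simp

lemma bounded_linear_cinner_left: "bounded_linear (\<lambda>x. cinner x y)"
  by (rule bounded_linear_intro[where K = "norm y"])
    (simp_all add: cinner_add_left cinner_scaleR_left scaleR_conv_of_real cinner_Cauchy_Schwarz)

lemma bounded_linear_cinner_right: "bounded_linear (\<lambda>y. cinner x y)"
  by (rule bounded_linear_intro[where K = "norm x"])
    (simp_all add: cinner_add_right cinner_scaleR_right scaleR_conv_of_real
      cinner_Cauchy_Schwarz mult.commute[of "norm _" "norm x"])

lemmas tendsto_cinner_left = bounded_linear.tendsto[OF bounded_linear_cinner_left]
lemmas continuous_on_cinner_left [continuous_intros] =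
  bounded_linear.continuous_on[OF bounded_linear_cinner_left]
lemmas continuous_on_cinner_right [continuous_intros] =
  bounded_linear.continuous_on[OF bounded_linear_cinner_right]

section \<open>Orthogonal projection, Riesz representation and adjoints\<close>

text \<open>A minimising sequence for the distance to \<open>M\<close> is Cauchy by the
  parallelogram law, and its limit \<open>p\<close> is a nearest point. If \<open>x - p\<close> had
  a component along some \<open>m\<close> in \<open>M\<close>, moving \<open>p\<close> by it would
  come closer still.\<close>

lemma closed_subspace_projection_exists:
  fixes M :: "'a::chilbert_space set"
  assumes sub: "complex_vector.subspace M" and cl: "closed M"
  obtains p where "p \<in> M" "\<And>m. m \<in> M \<Longrightarrow> cinner (x - p) m = 0"
proof -
  define d where "d = infdist x M"
  have M0: "M \<noteq> {}"
    using complex_vector.subspace_0[OF sub] by blast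
  have d0: "0 \<le> d"
    by (simp add: d_def infdist_nonneg)
  have d_le: "d \<le> norm (x - m)" if "m \<in> M" for m
    using infdist_le[OF that, of x] by (simp add: d_def dist_norm)
  have "\<exists>m\<in>M. norm (x - m) < d + inverse (Suc n)" for n
  proof -
    have "infdist x M < d + inverse (Suc n)"
      by (simp add: d_def)
    then show ?thesis
      using M0 cINF_less_iff[of M "dist x"] by (simp add: infdist_notempty flip: dist_norm)
  qed
  then obtain u where uM: "\<And>n. u n \<in> M" and u: "\<And>n. norm (x - u n) < d + inverse (Suc n)"
    by metis
  \<comment> \<open>The midpoint of \<open>u n\<close> and \<open>u k\<close> lies in
    \<open>M\<close>, so the sum term of the parallelogram law is at least
    \<open>4 * d\<^sup>2\<close>.\<close>
  have par: "(norm (u n - u k))\<^sup>2 \<le> 2 * (norm (x - u n))\<^sup>2 + 2 * (norm (x - u k))\<^sup>2 - 4 * d\<^sup>2" for n k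
  proof -
    have m: "(1/2) *\<^sub>R (u n + u k) \<in> M"
      using sub uM by (simp add: scaleR_scaleC complex_vector.subspace_add complex_vector.subspace_scale)
    have "(x - u n) + (x - u k) = 2 *\<^sub>R (x - (1/2) *\<^sub>R (u n + u k))"
      by (simp add: algebra_simps scaleR_2)
    then have "norm ((x - u n) + (x - u k)) = 2 * norm (x - (1/2) *\<^sub>R (u n + u k))"
      by simp
    then have "(norm ((x - u n) + (x - u k)))\<^sup>2 \<ge> 4 * d\<^sup>2"
      using d_le[OF m] d0 by (simp add: power_mono power_mult_distrib)
    moreover have "(norm ((x - u k) - (x - u n)))\<^sup>2 + (norm ((x - u n) + (x - u k)))\<^sup>2
      = 2 * (norm (x - u n))\<^sup>2 + 2 * (norm (x - u k))\<^sup>2"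
      unfolding norm_add_square norm_diff_square
      by (subst cinner_commute) simp
    moreover have "(x - u k) - (x - u n) = u n - u k"
      by simp
    ultimately show ?thesis
      by simp
  qed
  have "Cauchy u"
  proof (rule metric_CauchyI)
    fix e :: real assume e: "0 < e"
    \<comment> \<open>For indices from \<open>N\<close> on, \<open>par\<close> bounds the squared
      distance of two members of \<open>u\<close> by this expression at \<open>N\<close>.\<close>
    have "(\<lambda>n. 4 * (d + inverse (real (Suc n)))\<^sup>2 - 4 * d\<^sup>2) \<longlonglongrightarrow> 4 * (d + 0)\<^sup>2 - 4 * d\<^sup>2"
      by (intro tendsto_intros LIMSEQ_inverse_real_of_nat)
    then have "\<forall>\<^sub>F n in sequentially. 4 * (d + inverse (real (Suc n)))\<^sup>2 - 4 * d\<^sup>2 < e\<^sup>2"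
      using e by (intro order_tendstoD(2)[where y = "4 * (d + 0)\<^sup>2 - 4 * d\<^sup>2"]) auto
    then obtain N where N: "4 * (d + inverse (real (Suc N)))\<^sup>2 - 4 * d\<^sup>2 < e\<^sup>2"
      by (auto simp: eventually_sequentially)
    have le: "(norm (x - u n))\<^sup>2 \<le> (d + inverse (real (Suc N)))\<^sup>2" if "N \<le> n" for n
    proof -
      have "inverse (real (Suc n)) \<le> inverse (real (Suc N))"
        using that by (intro le_imp_inverse_le) auto
      then have "norm (x - u n) \<le> d + inverse (real (Suc N))"
        using u[of n] by linarith
      then show ?thesis
        by (simp add: power_mono)
    qed
    have "dist (u n) (u k) < e" if "N \<le> n" "N \<le> k" for n k
    proof -
      have "(norm (u n - u k))\<^sup>2 < e\<^sup>2"
        using par[of n k] le[OF that(1)] le[OF that(2)] N by linarith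
      then show ?thesis
        using e by (simp add: dist_norm power2_less_imp_less)
    qed
    then show "\<exists>M. \<forall>m\<ge>M. \<forall>n\<ge>M. dist (u m) (u n) < e"
      by blast
  qed
  then obtain p where p: "u \<longlonglongrightarrow> p"
    using Cauchy_convergent convergent_def by blast
  have pM: "p \<in> M"
    using closed_sequentially[OF cl _ p] uM by blast
  have np: "norm (x - p) \<le> d"
  proof (rule LIMSEQ_le)
    show "(\<lambda>n. norm (x - u n)) \<longlonglongrightarrow> norm (x - p)"
      by (intro tendsto_intros p)
    show "(\<lambda>n. d + inverse (real (Suc n))) \<longlonglongrightarrow> d"
      using tendsto_add[OF tendsto_const[of d] LIMSEQ_inverse_real_of_nat] by simp
  qed (use u less_imp_le in blast)
  have "cinner (x - p) m = 0" if m: "m \<in> M" for m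
  proof (rule ccontr)
    assume ne: "cinner (x - p) m \<noteq> 0"
    then have m0: "m \<noteq> 0"
      by auto
    define c where "c = cinner (x - p) m / of_real ((norm m)\<^sup>2)"
    have "p + c *\<^sub>C m \<in> M"
      using sub pM m by (simp add: complex_vector.subspace_add complex_vector.subspace_scale)
    then have "norm (x - p) \<le> norm ((x - p) - c *\<^sub>C m)"
      using d_le np by (metis diff_diff_add order_trans)
    then have "(norm (x - p))\<^sup>2 \<le> (norm ((x - p) - c *\<^sub>C m))\<^sup>2"
      by (simp add: power_mono)
    also have "\<dots> = (norm (x - p))\<^sup>2 - (cmod (cinner (x - p) m))\<^sup>2 / (norm m)\<^sup>2"
      unfolding c_def by (rule norm_diff_component_square[OF m0])
    finally show False
      using ne m0 by (simp add: divide_le_0_iff)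
  qed
  with pM that show ?thesis
    by blast
qed

text \<open>A suitable multiple of a vector \<open>w\<close> orthogonal to the closed kernel
  represents \<open>f\<close>, because subtracting a multiple of \<open>w\<close> moves any
  \<open>x\<close> into the kernel.\<close>

lemma Riesz_representation:
  fixes f :: "'a::chilbert_space \<Rightarrow> complex"
  assumes bl: "bounded_linear f" and cl: "\<And>c x. f (c *\<^sub>C x) = c * f x"
  obtains y where "\<And>x. f x = cinner x y"
proof (cases "\<forall>x. f x = 0")
  case True
  with that[of 0] show ?thesis
    by simp
next
  case False
  then obtain v where v: "f v \<noteq> 0"
    by blast
  interpret f: bounded_linear f
    by (rule bl)
  have "complex_vector.subspace {x. f x = 0}"
    by (rule complex_vector.subspaceI) (simp_all add: f.add f.zero cl)
  moreover have "closed {x. f x = 0}"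
    by (intro closed_Collect_eq f.continuous_on continuous_on_id continuous_on_const)
  ultimately obtain p where p: "f p = 0" and orth: "\<And>m. f m = 0 \<Longrightarrow> cinner (v - p) m = 0"
    by (rule closed_subspace_projection_exists[where x = v]) auto
  define w where "w = v - p"
  have fw: "f w = f v"
    by (simp add: w_def f.diff p)
  then have w0: "cinner w w \<noteq> 0"
    using v f.zero by (auto simp: cinner_self_eq_0)
  define y where "y = cnj (f v / cinner w w) *\<^sub>C w"
  have "f x = cinner x y" for x
  proof -
    have "f (x - (f x / f v) *\<^sub>C w) = 0"
      using v by (simp add: f.diff cl fw)
    then have "cinner w (x - (f x / f v) *\<^sub>C w) = 0"
      using orth w_def by blast
    then have "cinner (x - (f x / f v) *\<^sub>C w) w = 0"
      by (subst cinner_commute) simp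
    then have "cinner x w = (f x / f v) * cinner w w"
      by (simp add: cinner_simps)
    then show ?thesis
      using v w0 by (simp add: y_def cinner_scaleC_right)
  qed
  with that show ?thesis
    by blast
qed

lemma cinner_eq_imp_eq: "(\<And>z. cinner x z = cinner y z) \<Longrightarrow> x = y"
  by (metis cinner_diff_left cinner_self_eq_0 eq_iff_diff_eq_0)

text \<open>Riesz representation of \<open>\<lambda>x. cinner (f x) y\<close> for each
  \<open>y\<close>. The map is a plain function between two spaces because it is applied both to
  operators and to the embedding \<open>t g\<close> of the second tensor factor.\<close>

lemma adjoint_exists:
  fixes f :: "'a::chilbert_space \<Rightarrow> 'b::chilbert_space"
  assumes bl: "bounded_linear f" and cl: "\<And>c x. f (c *\<^sub>C x) = c *\<^sub>C f x"
  obtains f' where "bounded_linear f'" "\<And>c y. f' (c *\<^sub>C y) = c *\<^sub>C f' y"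
    "\<And>x y. cinner (f' y) x = cinner y (f x)"
proof -
  have "\<exists>w. \<forall>x. cinner (f x) y = cinner x w" for y
  proof -
    have "bounded_linear (\<lambda>x. cinner (f x) y)"
      using bounded_linear_compose[OF bounded_linear_cinner_left bl] by simp
    then show ?thesis
      using Riesz_representation[of "\<lambda>x. cinner (f x) y"] by (metis cl cinner_scaleC_left)
  qed
  then obtain f' where f': "\<And>y x. cinner (f x) y = cinner x (f' y)"
    by metis
  have f'': "cinner (f' y) x = cinner y (f x)" for x y
    by (metis cinner_commute f')
  obtain K where K: "0 < K" "\<And>x. norm (f x) \<le> norm x * K"
    using bounded_linear.pos_bounded[OF bl] by blast
  have "norm (f' y) \<le> norm y * K" for y
  proof (cases "f' y = 0")
    case False
    have "(norm (f' y))\<^sup>2 = cmod (cinner (f' y) (f' y))"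
      by (simp add: cinner_self norm_power)
    also have "\<dots> \<le> norm y * norm (f (f' y))"
      unfolding f'' by (rule cinner_Cauchy_Schwarz)
    also have "\<dots> \<le> norm y * (norm (f' y) * K)"
      by (intro mult_left_mono K) simp
    finally have "norm (f' y) * norm (f' y) \<le> norm (f' y) * (norm y * K)"
      by (simp add: power2_eq_square algebra_simps)
    then show ?thesis
      using False by simp
  qed (use K in simp)
  then have "bounded_linear f'"
    by (intro bounded_linear_intro[where K = K] cinner_eq_imp_eq)
      (simp_all add: f'' cinner_add_left cinner_scaleR_left)
  moreover have "f' (c *\<^sub>C y) = c *\<^sub>C f' y" for c y
    by (rule cinner_eq_imp_eq) (simp add: f'' cinner_scaleC_left)
  ultimately show ?thesis
    using that f'' by blast
qed

section \<open>Orbit projections and the weak operator topology\<close>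

lemma subspace_closure:
  fixes M :: "'a::chilbert_space set"
  assumes "complex_vector.subspace M"
  shows "complex_vector.subspace (closure M)"
proof (rule complex_vector.subspaceI)
  show "0 \<in> closure M"
    using complex_vector.subspace_0[OF assms] closure_subset by blast
next
  fix x y assume "x \<in> closure M" "y \<in> closure M"
  then obtain f g where "\<And>n. f n \<in> M" "f \<longlonglongrightarrow> x" "\<And>n. g n \<in> M" "g \<longlonglongrightarrow> y"
    unfolding closure_sequential by blast
  then have "\<And>n. f n + g n \<in> M" "(\<lambda>n. f n + g n) \<longlonglongrightarrow> x + y"
    using assms by (auto intro: tendsto_add complex_vector.subspace_add)
  then show "x + y \<in> closure M"
    unfolding closure_sequential by (intro exI[of _ "\<lambda>n. f n + g n"]) blast
next
  fix c x assume "x \<in> closure M"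
  then obtain f where "\<And>n. f n \<in> M" "f \<longlonglongrightarrow> x"
    unfolding closure_sequential by blast
  then have "\<And>n. c *\<^sub>C f n \<in> M" "(\<lambda>n. c *\<^sub>C f n) \<longlonglongrightarrow> c *\<^sub>C x"
    using assms bounded_linear.tendsto[OF bounded_linear_scaleC_right]
    by (auto intro: complex_vector.subspace_scale)
  then show "c *\<^sub>C x \<in> closure M"
    unfolding closure_sequential by (intro exI[of _ "\<lambda>n. c *\<^sub>C f n"]) blast
qed

text \<open>Makes the definite description usable: two candidates differ by a vector of
  \<open>M\<close> that is orthogonal to itself.\<close>

lemma orth_proj_equality:
  fixes M :: "'a::chilbert_space set"
  assumes "complex_vector.subspace M" "p \<in> M" "\<And>m. m \<in> M \<Longrightarrow> cinner (x - p) m = 0"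
  shows "orth_proj M x = p"
  unfolding orth_proj_def
proof (rule the_equality)
  fix q assume q: "q \<in> M \<and> (\<forall>m\<in>M. cinner (x - q) m = 0)"
  then have "q - p \<in> M"
    using assms complex_vector.subspace_diff by blast
  then have "cinner (x - p) (q - p) - cinner (x - q) (q - p) = 0"
    using assms(3) q by simp
  then have "cinner (q - p) (q - p) = 0"
    by (simp flip: cinner_diff_left)
  then show "q = p"
    by (simp add: cinner_self_eq_0)
qed (use assms in blast)

lemma orth_proj_closed_subspace:
  fixes M :: "'a::chilbert_space set"
  assumes "complex_vector.subspace M" "closed M"
  shows "orth_proj M x \<in> M" and "m \<in> M \<Longrightarrow> cinner (x - orth_proj M x) m = 0"
proof -
  obtain p where p: "p \<in> M" "\<And>m. m \<in> M \<Longrightarrow> cinner (x - p) m = 0"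
    using closed_subspace_projection_exists[OF assms] by metis
  moreover have "orth_proj M x = p"
    by (rule orth_proj_equality[OF assms(1) p])
  ultimately show "orth_proj M x \<in> M" and "m \<in> M \<Longrightarrow> cinner (x - orth_proj M x) m = 0"
    by simp_all
qed

lemma norm_diff_orth_proj_le:
  fixes M :: "'a::chilbert_space set"
  assumes "complex_vector.subspace M" "closed M"
  shows "norm (x - orth_proj M x) \<le> norm x"
proof -
  let ?p = "orth_proj M x"
  have "(norm ((x - ?p) + ?p))\<^sup>2 = (norm (x - ?p))\<^sup>2 + (norm ?p)\<^sup>2"
    using orth_proj_closed_subspace[OF assms] by (subst norm_add_square) simp
  then have "(norm (x - ?p))\<^sup>2 \<le> (norm x)\<^sup>2"
    by simp
  then show ?thesis
    by (rule power2_le_imp_le) simp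
qed

lemma blinfun_apply_scaleC [simp]: "blinfun_apply (c *\<^sub>C A) x = c *\<^sub>C blinfun_apply A x"
  by (simp add: scaleC_blinfun.rep_eq)

lemma subspace_orbit_closure:
  assumes "complex_vector.subspace S"
  shows "complex_vector.subspace (orbit_closure S x)"
  unfolding orbit_closure_def
proof (rule subspace_closure, rule complex_vector.subspaceI)
  show "0 \<in> (\<lambda>A. blinfun_apply A x) ` S"
    using complex_vector.subspace_0[OF assms] by (auto intro!: image_eqI[of _ _ 0])
next
  fix y z assume "y \<in> (\<lambda>A. blinfun_apply A x) ` S" "z \<in> (\<lambda>A. blinfun_apply A x) ` S"
  then obtain A B where "A \<in> S" "y = blinfun_apply A x" "B \<in> S" "z = blinfun_apply B x"
    by blast
  then show "y + z \<in> (\<lambda>A. blinfun_apply A x) ` S"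
    using complex_vector.subspace_add[OF assms]
    by (auto intro!: image_eqI[of _ _ "A + B"] simp: blinfun.add_left)
next
  fix c y assume "y \<in> (\<lambda>A. blinfun_apply A x) ` S"
  then obtain A where "A \<in> S" "y = blinfun_apply A x"
    by blast
  then show "c *\<^sub>C y \<in> (\<lambda>A. blinfun_apply A x) ` S"
    using complex_vector.subspace_scale[OF assms] by (auto intro!: image_eqI[of _ _ "c *\<^sub>C A"])
qed

text \<open>A real supremum dominates its terms only if they are bounded above; here
  \<open>norm A\<close> is a bound, since a residual is no longer than the projected vector.\<close>

lemma norm_residual_le_hyperreflexivity_beta:
  assumes S: "complex_vector.subspace S" and e: "norm e = 1"
  shows "norm (blinfun_apply A e - orth_proj (orbit_closure S e) (blinfun_apply A e))
    \<le> hyperreflexivity_beta S A"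
proof -
  define r where "r = (\<lambda>y. norm (blinfun_apply A y - orth_proj (orbit_closure S y) (blinfun_apply A y)))"
  have "closed (orbit_closure S y)" for y
    by (simp add: orbit_closure_def)
  then have "r y \<le> norm A" if "norm y = 1" for y
    using norm_diff_orth_proj_le[OF subspace_orbit_closure[OF S]] norm_blinfun[of A y] that order_trans
    unfolding r_def by fastforce
  then have "bdd_above (r ` {y. norm y = 1})"
    by (intro bdd_aboveI[of _ "norm A"]) auto
  then have "r e \<le> hyperreflexivity_beta S A"
    unfolding hyperreflexivity_beta_def r_def[symmetric] using e by (intro cSUP_upper) auto
  then show ?thesis
    by (simp add: r_def)
qed

text \<open>The only form in which \<beta> enters the upper estimates. If \<open>z\<close> is
  orthogonal to the orbit of \<open>x\<close>, it is orthogonal to the projection too, so only the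
  residual of \<open>A x\<close> contributes.\<close>

lemma cmod_cinner_le_hyperreflexivity_beta:
  fixes S :: "('h::chilbert_space \<Rightarrow>\<^sub>L 'h) set"
  assumes S: "complex_vector.subspace S" and S_ops: "S \<subseteq> bounded_ops" and A: "A \<in> bounded_ops"
    and orth: "\<And>C. C \<in> S \<Longrightarrow> cinner (blinfun_apply C x) z = 0"
  shows "cmod (cinner (blinfun_apply A x) z) \<le> hyperreflexivity_beta S A * (norm x * norm z)"
proof (cases "x = 0")
  case False
  define e where "e = complex_of_real (inverse (norm x)) *\<^sub>C x"
  have e: "norm e = 1" "x = complex_of_real (norm x) *\<^sub>C e"
    using False by (simp_all add: e_def norm_scaleC scaleC_scaleC norm_inverse scaleC_one
        flip: of_real_mult)
  define p where "p = orth_proj (orbit_closure S e) (blinfun_apply A e)"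
  have p: "p \<in> orbit_closure S e"
    unfolding p_def using subspace_orbit_closure[OF S]
    by (intro orth_proj_closed_subspace) (simp_all add: orbit_closure_def)
  have "cinner (blinfun_apply C e) z = 0" if "C \<in> S" for C
    using S_ops that orth[OF that] by (auto simp: e_def bounded_ops_def cinner_scaleC_left)
  then have "(\<lambda>C. blinfun_apply C e) ` S \<subseteq> {w. cinner w z = 0}"
    by auto
  moreover have "closed {w. cinner w z = 0}"
    by (intro closed_Collect_eq continuous_on_cinner_left continuous_on_id continuous_on_const)
  ultimately have "cinner p z = 0"
    using closure_minimal p unfolding orbit_closure_def by blast
  then have "cmod (cinner (blinfun_apply A e) z) = cmod (cinner (blinfun_apply A e - p) z)"
    by (simp add: cinner_diff_left)
  also have "\<dots> \<le> norm (blinfun_apply A e - p) * norm z"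
    by (rule cinner_Cauchy_Schwarz)
  also have "\<dots> \<le> hyperreflexivity_beta S A * norm z"
    unfolding p_def using norm_residual_le_hyperreflexivity_beta[OF S e(1)]
    by (simp add: mult_right_mono)
  finally have "cmod (cinner (blinfun_apply A e) z) \<le> hyperreflexivity_beta S A * norm z" .
  moreover have "blinfun_apply A x = complex_of_real (norm x) *\<^sub>C blinfun_apply A e"
    using A e(2) unfolding bounded_ops_def by (metis (mono_tags, lifting) mem_Collect_eq)
  ultimately show ?thesis
    by (simp add: cinner_scaleC_left norm_mult mult_left_mono mult.left_commute)
qed simp

section \<open>Operator sets cut out by equations between matrix coefficients\<close>

lemma closed_bounded_ops: "closed bounded_ops"
proof -
  have "bounded_ops = (\<Inter>c x. {A :: 'a \<Rightarrow>\<^sub>L 'a. blinfun_apply A (c *\<^sub>C x) = c *\<^sub>C blinfun_apply A x})"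
    by (auto simp: bounded_ops_def)
  also have "closed \<dots>"
    by (intro closed_INT ballI closed_Collect_eq continuous_intros
        bounded_linear.continuous_on[OF bounded_linear_scaleC_right])
  finally show ?thesis .
qed

lemma subspace_bounded_ops: "complex_vector.subspace bounded_ops"
  by (rule complex_vector.subspaceI)
    (auto simp: bounded_ops_def blinfun.add_left scaleC_add_right scaleC_scaleC mult.commute)

lemma topspace_weak_operator_topology [simp]: "topspace weak_operator_topology = bounded_ops"
  by (simp add: weak_operator_topology_def topspace_pullback_topology)

text \<open>Coefficients are continuous in the weak operator topology, and each equation is the
  preimage of \<open>{0}\<close>. With the next two lemmas, such a set absorbs spans, norm closures
  and weak closures of its subsets.\<close>

lemma closedin_weak_operator_topology_coefficients:
  "closedin weak_operator_topology {A \<in> bounded_ops.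
    \<forall>i\<in>I. cinner (blinfun_apply A (u i)) (v i) = c i * cinner (blinfun_apply A (u' i)) (v' i)}"
\<comment> \<open>An intersection over an empty family would not be contained in
  \<open>bounded_ops\<close>.\<close>
proof (cases "I = {}")
  case False
  have "closedin weak_operator_topology {A \<in> topspace weak_operator_topology.
    ((\<lambda>\<phi>. \<phi> (u i) (v i) - c i * \<phi> (u' i) (v' i)) \<circ> (\<lambda>A x y. cinner (blinfun_apply A x) y)) A \<in> {0}}" for i
  proof (rule closedin_continuous_map_preimage)
    show "continuous_map weak_operator_topology euclidean
      ((\<lambda>\<phi>. \<phi> (u i) (v i) - c i * \<phi> (u' i) (v' i)) \<circ> (\<lambda>A x y. cinner (blinfun_apply A x) y))"
      unfolding weak_operator_topology_def
    proof (rule continuous_map_pullback)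
      have "continuous_on UNIV (\<lambda>\<phi> :: 'a \<Rightarrow> 'a \<Rightarrow> complex. \<phi> x y)" for x y
        by (rule continuous_on_product_then_coordinatewise[OF continuous_on_product_coordinates])
      then show "continuous_map euclidean euclidean
        (\<lambda>\<phi> :: 'a \<Rightarrow> 'a \<Rightarrow> complex. \<phi> (u i) (v i) - c i * \<phi> (u' i) (v' i))"
        unfolding continuous_map_iff_continuous2
        by (intro continuous_on_diff continuous_on_mult continuous_on_const)
    qed
  qed simp
  then have "closedin weak_operator_topology (\<Inter>i\<in>I. {A \<in> bounded_ops.
      cinner (blinfun_apply A (u i)) (v i) = c i * cinner (blinfun_apply A (u' i)) (v' i)})"
    using False by (intro closedin_INT) simp_all
  also have "(\<Inter>i\<in>I. {A \<in> bounded_ops.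
      cinner (blinfun_apply A (u i)) (v i) = c i * cinner (blinfun_apply A (u' i)) (v' i)})
    = {A \<in> bounded_ops. \<forall>i\<in>I.
      cinner (blinfun_apply A (u i)) (v i) = c i * cinner (blinfun_apply A (u' i)) (v' i)}"
    using False by blast
  finally show ?thesis .
qed (use closedin_topspace[of weak_operator_topology] in simp)

lemma closed_coefficients:
  "closed {A \<in> bounded_ops.
    \<forall>i\<in>I. cinner (blinfun_apply A (u i)) (v i) = c i * cinner (blinfun_apply A (u' i)) (v' i)}"
proof -
  have "closed (bounded_ops \<inter> (\<Inter>i\<in>I. {A. cinner (blinfun_apply A (u i)) (v i)
      = c i * cinner (blinfun_apply A (u' i)) (v' i)}))"
    by (intro closed_Int closed_bounded_ops closed_INT ballI closed_Collect_eq continuous_intros)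
  then show ?thesis
    by (rule back_subst[of closed]) auto
qed

lemma subspace_coefficients:
  "complex_vector.subspace {A \<in> bounded_ops.
    \<forall>i\<in>I. cinner (blinfun_apply A (u i)) (v i) = c i * cinner (blinfun_apply A (u' i)) (v' i)}"
  by (rule complex_vector.subspaceI)
    (simp_all add: blinfun.add_left cinner_add_left cinner_scaleC_left distrib_left
      complex_vector.subspace_0 complex_vector.subspace_add complex_vector.subspace_scale
      subspace_bounded_ops)

section \<open>Hilbert space tensor products\<close>

definition orthonormal_on :: "'i set \<Rightarrow> ('i \<Rightarrow> 'a::chilbert_space) \<Rightarrow> bool"
  where "orthonormal_on I e \<longleftrightarrow> (\<forall>i\<in>I. \<forall>j\<in>I. cinner (e i) (e j) = (if i = j then 1 else 0))"

lemma norm_orthonormal_on: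
  assumes "orthonormal_on I e" "i \<in> I"
  shows "norm (e i) = 1"
proof -
  have "complex_of_real ((norm (e i))\<^sup>2) = 1"
    unfolding cinner_self[symmetric] using assms by (simp add: orthonormal_on_def)
  then have "(norm (e i))\<^sup>2 = 1"
    by (simp only: of_real_eq_1_iff)
  then show ?thesis
    by (simp add: power2_eq_1_iff) (metis norm_ge_zero neg_0_le_iff_le not_one_le_zero)
qed

text \<open>At most one vector, the normalised residual of \<open>k\<close>, is appended. The old
  vectors stay in place, so expansions along them remain valid.\<close>

lemma Gram_Schmidt_step:
  fixes e :: "nat \<Rightarrow> 'a::chilbert_space"
  assumes on: "orthonormal_on {..<m} e"
  obtains e' m' c where "m \<le> m'" "\<And>i. i < m \<Longrightarrow> e' i = e i" "orthonormal_on {..<m'} e'"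
    "k = (\<Sum>i<m'. c i *\<^sub>C e' i)"
proof -
  define r where "r = k - (\<Sum>i<m. cinner k (e i) *\<^sub>C e i)"
  have k: "k = (\<Sum>i<m. cinner k (e i) *\<^sub>C e i) + r"
    by (simp add: r_def)
  have re: "cinner r (e j) = 0" if "j < m" for j
  proof -
    have "cinner (\<Sum>i<m. cinner k (e i) *\<^sub>C e i) (e j)
        = (\<Sum>i<m. if i = j then cinner k (e i) else 0)"
      unfolding cinner_sum_left using on that
      by (intro sum.cong refl) (simp add: cinner_scaleC_left orthonormal_on_def)
    then show ?thesis
      using that by (simp add: r_def cinner_diff_left)
  qed
  show ?thesis
  proof (cases "r = 0")
    case True
    with that[of m e "\<lambda>i. cinner k (e i)"] on k show ?thesis
      by simp
  next
    case False
    define e' where "e' = e(m := complex_of_real (inverse (norm r)) *\<^sub>C r)"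
    have er: "cinner (e j) r = 0" if "j < m" for j
      using re[OF that] by (subst cinner_commute) simp
    have "cinner (e' m) (e' m) = 1"
      using False by (simp add: cinner_self e'_def norm_scaleC norm_inverse del: of_real_inverse)
    then have "orthonormal_on {..<Suc m} e'"
      using on re er by (auto simp: orthonormal_on_def less_Suc_eq e'_def cinner_simps)
    moreover have "k = (\<Sum>i<Suc m. (if i < m then cinner k (e i) else of_real (norm r)) *\<^sub>C e' i)"
      using k False by (simp add: e'_def scaleC_scaleC scaleC_one flip: of_real_mult)
    moreover have "e' i = e i" if "i < m" for i
      using that by (simp add: e'_def)
    ultimately show ?thesis
      using that[of "Suc m" e'] by (metis le_add2 plus_1_eq_Suc)
  qed
qed

section \<open>Elementary tensors and density\<close>

locale hilbert_tensor =
  fixes t :: "'h::chilbert_space \<Rightarrow> 'k::chilbert_space \<Rightarrow> 'l::chilbert_space"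
  assumes tensor: "is_hilbert_tensor t"
begin

lemma tensor_add_left: "t (x + x') y = t x y + t x' y"
  and tensor_add_right: "t x (y + y') = t x y + t x y'"
  and tensor_scaleC_left: "t (c *\<^sub>C x) y = c *\<^sub>C t x y"
  and tensor_scaleC_right: "t x (c *\<^sub>C y) = c *\<^sub>C t x y"
  and cinner_tensor: "cinner (t x y) (t x' y') = cinner x x' * cinner y y'"
  using tensor by (simp_all add: is_hilbert_tensor_def)

text \<open>The axioms are symmetric, so results on operators of the first factor transfer to the
  second.\<close>

lemma swapped: "hilbert_tensor (\<lambda>y x. t x y)"
proof -
  have "{t x y | y x. True} = {t x y | x y. True}"
    by blast
  then show ?thesis
    using tensor by unfold_locales (simp add: is_hilbert_tensor_def mult.commute)
qed

lemma tensor_zero_left [simp]: "t 0 y = 0"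
  using tensor_add_left[of 0 0 y] by simp

lemma tensor_zero_right [simp]: "t x 0 = 0"
  using tensor_add_right[of x 0 0] by simp

lemma tensor_sum_right: "t x (\<Sum>i\<in>I. f i) = (\<Sum>i\<in>I. t x (f i))"
  by (induction I rule: infinite_finite_induct) (simp_all add: tensor_add_right)

lemma tensor_sum_left: "t (\<Sum>i\<in>I. f i) y = (\<Sum>i\<in>I. t (f i) y)"
  by (induction I rule: infinite_finite_induct) (simp_all add: tensor_add_left)

lemma norm_tensor: "norm (t x y) = norm x * norm y"
proof -
  have "complex_of_real ((norm (t x y))\<^sup>2) = complex_of_real ((norm x * norm y)\<^sup>2)"
    using cinner_tensor[of x y x y] by (simp add: cinner_self power_mult_distrib)
  then have "(norm (t x y))\<^sup>2 = (norm x * norm y)\<^sup>2"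
    using of_real_eq_iff by blast
  then show ?thesis
    by (simp add: power2_eq_iff_nonneg)
qed

definition alg_tensor :: "'l set"
  where "alg_tensor = complex_vector.span {t x y | x y. True}"

lemma closure_alg_tensor: "closure alg_tensor = UNIV"
  using tensor by (simp add: is_hilbert_tensor_def alg_tensor_def)

lemma subspace_alg_tensor: "complex_vector.subspace alg_tensor"
  by (simp add: alg_tensor_def complex_vector.subspace_span)

lemma closed_superset_alg_tensor: "closed X \<Longrightarrow> alg_tensor \<subseteq> X \<Longrightarrow> x \<in> X"
  using closure_minimal[of alg_tensor X] closure_alg_tensor by blast

lemma tensor_total:
  assumes "\<And>x y. cinner w (t x y) = cinner w' (t x y)"
  shows "w = w'"
proof (rule cinner_eq_imp_eq)
  fix z
  have "complex_vector.subspace {z. cinner w z = cinner w' z}"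
    by (rule complex_vector.subspaceI) (simp_all add: cinner_simps)
  then have "alg_tensor \<subseteq> {z. cinner w z = cinner w' z}"
    unfolding alg_tensor_def using assms by (intro complex_vector.span_minimal) auto
  moreover have "closed {z. cinner w z = cinner w' z}"
    by (intro closed_Collect_eq continuous_on_cinner_right continuous_on_id)
  ultimately show "cinner w z = cinner w' z"
    using closed_superset_alg_tensor by blast
qed

lemma blinfun_eq_on_tensors:
  assumes "C \<in> bounded_ops" "D \<in> bounded_ops"
    and "\<And>x y. blinfun_apply C (t x y) = blinfun_apply D (t x y)"
  shows "C = D"
proof (rule blinfun_eqI)
  fix z
  have "complex_vector.subspace {z. blinfun_apply C z = blinfun_apply D z}"
    using assms(1,2)
    by (intro complex_vector.subspaceI) (simp_all add: blinfun.add_right bounded_ops_def)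
  then have "alg_tensor \<subseteq> {z. blinfun_apply C z = blinfun_apply D z}"
    unfolding alg_tensor_def using assms(3) by (intro complex_vector.span_minimal) auto
  moreover have "closed {z. blinfun_apply C z = blinfun_apply D z}"
    by (intro closed_Collect_eq continuous_intros)
  ultimately show "blinfun_apply C z = blinfun_apply D z"
    using closed_superset_alg_tensor by blast
qed

text \<open>The summands are pairwise orthogonal, because the inner product of tensors is
  multiplicative.\<close>

lemma norm_orthonormal_sum:
  assumes "finite I" "orthonormal_on I e"
  shows "(norm (\<Sum>i\<in>I. t (x i) (e i)))\<^sup>2 = (\<Sum>i\<in>I. (norm (x i))\<^sup>2)"
proof -
  have "complex_of_real ((norm (\<Sum>i\<in>I. t (x i) (e i)))\<^sup>2)
      = (\<Sum>i\<in>I. \<Sum>j\<in>I. if i = j then cinner (x i) (x j) else 0)"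
    unfolding cinner_self[symmetric] cinner_sum_left cinner_sum_right using assms(2)
    by (intro sum.cong refl) (simp add: cinner_tensor orthonormal_on_def)
  also have "\<dots> = complex_of_real (\<Sum>i\<in>I. (norm (x i))\<^sup>2)"
    using assms(1) by (simp add: cinner_self)
  finally show ?thesis
    using of_real_eq_iff by blast
qed

section \<open>Orthonormal expansions in the algebraic tensor product\<close>

text \<open>The quantifier over the initial system \<open>e\<close> lets the induction absorb one
  elementary tensor at a time, and later lets two vectors share a system.\<close>

lemma orthonormal_expansion_extend:
  assumes "y \<in> alg_tensor"
  shows "\<forall>(e :: nat \<Rightarrow> 'k) m. orthonormal_on {..<m} e \<longrightarrow> (\<exists>e' m' x. m \<le> m' \<and> (\<forall>i<m. e' i = e i)
    \<and> orthonormal_on {..<m'} e' \<and> y = (\<Sum>i<m'. t (x i) (e' i)))"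
  using assms unfolding alg_tensor_def
proof (induction rule: complex_vector.span_induct_alt)
  case base
  show ?case
  proof (intro allI impI)
    fix e :: "nat \<Rightarrow> 'k" and m
    assume "orthonormal_on {..<m} e"
    then show "\<exists>e' m' x. m \<le> m' \<and> (\<forall>i<m. e' i = e i) \<and> orthonormal_on {..<m'} e'
        \<and> 0 = (\<Sum>i<m'. t (x i) (e' i))"
      by (intro exI[of _ e] exI[of _ m] exI[of _ "\<lambda>_. 0"]) simp
  qed
next
  case (step c z y)
  then obtain a k where z: "z = t a k"
    by blast
  show ?case
  proof (intro allI impI)
    fix e :: "nat \<Rightarrow> 'k" and m
    assume "orthonormal_on {..<m} e"
    then obtain e1 m1 b where 1: "m \<le> m1" "\<And>i. i < m \<Longrightarrow> e1 i = e i" "orthonormal_on {..<m1} e1"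
      "k = (\<Sum>i<m1. b i *\<^sub>C e1 i)"
      by (rule Gram_Schmidt_step[where k = k]) (rule that)
    \<comment> \<open>The induction hypothesis starts from a system that already expands
      \<open>k\<close>, so the result expands both \<open>c *\<^sub>C z\<close> and
      \<open>y\<close>.\<close>
    obtain e2 m2 x where 2: "m1 \<le> m2" "\<And>i. i < m1 \<Longrightarrow> e2 i = e1 i" "orthonormal_on {..<m2} e2"
      "y = (\<Sum>i<m2. t (x i) (e2 i))"
      using step.IH[rule_format, OF 1(3)] by blast
    have "c *\<^sub>C z = (\<Sum>i<m1. t ((c * b i) *\<^sub>C a) (e2 i))"
      using 2(2)
      by (simp add: z 1(4) tensor_sum_right tensor_scaleC_left tensor_scaleC_right
          complex_vector.scale_sum_right scaleC_scaleC)
    also have "\<dots> = (\<Sum>i<m2. t (if i < m1 then (c * b i) *\<^sub>C a else 0) (e2 i))"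
      using 2(1) by (intro sum.mono_neutral_cong_left) auto
    finally have "c *\<^sub>C z + y = (\<Sum>i<m2. t ((if i < m1 then (c * b i) *\<^sub>C a else 0) + x i) (e2 i))"
      by (simp add: 2(4) tensor_add_left sum.distrib)
    moreover have "m \<le> m2" "\<forall>i<m. e2 i = e i"
      using 1(1,2) 2(1,2) by auto
    ultimately show "\<exists>e' m' x. m \<le> m' \<and> (\<forall>i<m. e' i = e i) \<and> orthonormal_on {..<m'} e'
        \<and> c *\<^sub>C z + y = (\<Sum>i<m'. t (x i) (e' i))"
      using 2(3) by (intro exI[of _ e2] exI[of _ m2] exI) auto
  qed
qed

lemma orthonormal_expansion:
  assumes "y \<in> alg_tensor"
  obtains e :: "nat \<Rightarrow> 'k" and m x where "orthonormal_on {..<m} e" "y = (\<Sum>i<m. t (x i) (e i))"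
proof -
  have "orthonormal_on {..<0 :: nat} (\<lambda>_. 0 :: 'k)"
    by (simp add: orthonormal_on_def)
  with orthonormal_expansion_extend[OF assms] that show ?thesis
    by blast
qed

lemma common_orthonormal_expansion:
  assumes "y \<in> alg_tensor" "z \<in> alg_tensor"
  obtains e :: "nat \<Rightarrow> 'k" and m u v where "orthonormal_on {..<m} e"
    "y = (\<Sum>i<m. t (u i) (e i))" "z = (\<Sum>i<m. t (v i) (e i))"
proof -
  obtain e1 :: "nat \<Rightarrow> 'k" and m1 u where 1: "orthonormal_on {..<m1} e1" "y = (\<Sum>i<m1. t (u i) (e1 i))"
    by (rule orthonormal_expansion[OF assms(1)])
  obtain e m v where 2: "m1 \<le> m" "\<And>i. i < m1 \<Longrightarrow> e i = e1 i" "orthonormal_on {..<m} e"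
    "z = (\<Sum>i<m. t (v i) (e i))"
    using orthonormal_expansion_extend[OF assms(2), rule_format, OF 1(1)] by blast
  have "y = (\<Sum>i<m. t (if i < m1 then u i else 0) (e i))"
    unfolding 1(2) using 2(1,2) by (intro sum.mono_neutral_cong_left) auto
  from that[OF 2(3) this 2(4)] show ?thesis .
qed

section \<open>Tensor products of operators\<close>

text \<open>Constructs \<open>A\<close> tensor identity. Along an orthonormal expansion the operator
  acts on the coefficients, so the bound \<open>norm A\<close> is Pythagoras; density and
  completeness extend it to the whole space.\<close>

lemma amplification_exists:
  assumes "A \<in> bounded_ops"
  obtains C where "C \<in> bounded_ops" "\<And>x y. blinfun_apply C (t x y) = t (blinfun_apply A x) y"
proof -
  obtain A' where A': "\<And>x y. cinner (A' y) x = cinner y (blinfun_apply A x)"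
    by (rule adjoint_exists[OF blinfun.bounded_linear_right[of A]])
      (use assms in \<open>auto simp: bounded_ops_def\<close>)
  have A'': "cinner x (A' y) = cinner (blinfun_apply A x) y" for x y
    by (metis A' cinner_commute)
  \<comment> \<open>The adjoint \<open>A'\<close> characterises the image \<open>w\<close> of
    \<open>y\<close> without reference to an expansion, so well-definedness and linearity follow
    from uniqueness.\<close>
  define rel where "rel = (\<lambda>y w. \<forall>x k. cinner w (t x k) = cinner y (t (A' x) k))"
  have rel_unique: "w = w'" if "rel y w" "rel y w'" for y w w'
    using that unfolding rel_def by (intro tensor_total) simp
  have rel_add: "rel (y + y') (w + w')" and rel_diff: "rel (y - y') (w - w')"
    and rel_scale: "rel (c *\<^sub>C y) (c *\<^sub>C w)" if "rel y w" "rel y' w'" for y y' w w' c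
    using that by (simp_all add: rel_def cinner_simps)
  have ex_alg: "\<exists>w. rel y w \<and> norm w \<le> norm A * norm y" if y_alg: "y \<in> alg_tensor" for y
  proof -
    obtain e :: "nat \<Rightarrow> 'k" and m x where e: "orthonormal_on {..<m} e" and y: "y = (\<Sum>i<m. t (x i) (e i))"
      by (rule orthonormal_expansion[OF y_alg])
    define w where "w = (\<Sum>i<m. t (blinfun_apply A (x i)) (e i))"
    have "rel y w"
      by (simp add: rel_def y w_def cinner_sum_left cinner_tensor A'')
    moreover have "(norm w)\<^sup>2 \<le> (norm A * norm y)\<^sup>2"
    proof -
      have "(norm w)\<^sup>2 = (\<Sum>i<m. (norm (blinfun_apply A (x i)))\<^sup>2)"
        unfolding w_def by (rule norm_orthonormal_sum) (use e in auto)
      also have "\<dots> \<le> (\<Sum>i<m. (norm A * norm (x i))\<^sup>2)"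
        by (intro sum_mono power_mono norm_blinfun) simp
      also have "\<dots> = (norm A)\<^sup>2 * (norm y)\<^sup>2"
        unfolding y using norm_orthonormal_sum[OF _ e, of x]
        by (simp add: power_mult_distrib sum_distrib_left)
      finally show ?thesis
        by (simp add: power_mult_distrib)
    qed
    then have "norm w \<le> norm A * norm y"
      by (rule power2_le_imp_le) simp
    ultimately show ?thesis
      by blast
  qed
  have "\<exists>w. rel y w \<and> norm w \<le> norm A * norm y" for y
  proof -
    obtain f where f: "\<And>n. f n \<in> alg_tensor" "f \<longlonglongrightarrow> y"
      using closure_alg_tensor unfolding closure_sequential by (metis UNIV_I closure_sequential)
    obtain g where g: "\<And>n. rel (f n) (g n)" "\<And>n. norm (g n) \<le> norm A * norm (f n)"
      using ex_alg[OF f(1)] by metis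
    \<comment> \<open>By uniqueness \<open>g n - g k\<close> is the image of
      \<open>f n - f k\<close>, so the bound on the algebraic tensor product applies to it.\<close>
    have lip: "norm (g n - g k) \<le> norm A * norm (f n - f k)" for n k
    proof -
      have "f n - f k \<in> alg_tensor"
        using f(1) subspace_alg_tensor complex_vector.subspace_diff by blast
      then show ?thesis
        using ex_alg rel_unique rel_diff[OF g(1) g(1)] by metis
    qed
    have "Cauchy g"
    proof (rule metric_CauchyI)
      fix \<epsilon> :: real assume "0 < \<epsilon>"
      moreover have pos: "0 < norm A + 1"
        using norm_ge_zero[of A] by linarith
      ultimately have "0 < \<epsilon> / (norm A + 1)"
        by simp
      then obtain N where N: "\<And>n k. N \<le> n \<Longrightarrow> N \<le> k \<Longrightarrow> dist (f n) (f k) < \<epsilon> / (norm A + 1)"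
        using LIMSEQ_imp_Cauchy[OF f(2)] metric_CauchyD by metis
      have "dist (g n) (g k) < \<epsilon>" if "N \<le> n" "N \<le> k" for n k
      proof -
        have "norm (g n - g k) \<le> (norm A + 1) * norm (f n - f k)"
          using lip[of n k] by (simp add: distrib_right add_increasing2)
        also have "\<dots> < \<epsilon>"
          using N[OF that] pos by (simp add: dist_norm pos_less_divide_eq mult.commute)
        finally show ?thesis
          by (simp add: dist_norm)
      qed
      then show "\<exists>M. \<forall>m\<ge>M. \<forall>n\<ge>M. dist (g m) (g n) < \<epsilon>"
        by blast
    qed
    then obtain w where w: "g \<longlonglongrightarrow> w"
      using Cauchy_convergent convergent_def by blast
    have "cinner w (t x k) = cinner y (t (A' x) k)" for x k
    proof (rule LIMSEQ_unique)
      show "(\<lambda>n. cinner (g n) (t x k)) \<longlonglongrightarrow> cinner w (t x k)"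
        by (rule tendsto_cinner_left[OF w])
      show "(\<lambda>n. cinner (g n) (t x k)) \<longlonglongrightarrow> cinner y (t (A' x) k)"
        using tendsto_cinner_left[OF f(2), of "t (A' x) k"] g(1) by (simp add: rel_def)
    qed
    moreover have "norm w \<le> norm A * norm y"
      by (rule LIMSEQ_le[OF tendsto_norm[OF w] tendsto_mult_left[OF tendsto_norm[OF f(2)]]])
        (use g(2) in blast)
    ultimately show ?thesis
      unfolding rel_def by blast
  qed
  then obtain C where C: "\<And>y. rel y (C y)" "\<And>y. norm (C y) \<le> norm A * norm y"
    by metis
  have scale: "C (c *\<^sub>C y) = c *\<^sub>C C y" for c y
    using rel_unique C(1) rel_scale[OF C(1) C(1)] by blast
  have "bounded_linear C"
  proof (rule bounded_linear_intro[where K = "norm A"])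
    show "C (y + y') = C y + C y'" for y y'
      using rel_unique C(1) rel_add[OF C(1) C(1)] by blast
  qed (use C(2) in \<open>simp_all add: scaleR_scaleC scale mult.commute\<close>)
  then have "blinfun_apply (Blinfun C) = C"
    by (rule bounded_linear_Blinfun_apply)
  moreover have "C (t x y) = t (blinfun_apply A x) y" for x y
    using C(1)[of "t x y"] by (intro tensor_total) (simp add: rel_def cinner_tensor A'')
  ultimately show ?thesis
    using that[of "Blinfun C"] scale by (simp add: bounded_ops_def)
qed

text \<open>The product of the two amplifications, \<open>A\<close> tensor identity and identity
  tensor \<open>B\<close>.\<close>

lemma op_tensor_exists:
  assumes "A \<in> bounded_ops" "B \<in> bounded_ops"
  obtains C where "C \<in> bounded_ops"
    "\<And>x y. blinfun_apply C (t x y) = t (blinfun_apply A x) (blinfun_apply B y)"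
proof -
  obtain C where C: "C \<in> bounded_ops" "\<And>x y. blinfun_apply C (t x y) = t (blinfun_apply A x) y"
    by (rule amplification_exists[OF assms(1)]) (rule that)
  obtain D where D: "D \<in> bounded_ops" "\<And>x y. blinfun_apply D (t x y) = t x (blinfun_apply B y)"
    by (rule hilbert_tensor.amplification_exists[OF swapped assms(2)]) (rule that)
  show ?thesis
    by (rule that[of "C o\<^sub>L D"]) (use C D in \<open>simp_all add: bounded_ops_def\<close>)
qed

lemma op_tensor_equality:
  assumes "C \<in> bounded_ops"
    and "\<And>x y. blinfun_apply C (t x y) = t (blinfun_apply A x) (blinfun_apply B y)"
  shows "op_tensor t A B = C"
  unfolding op_tensor_def
  by (rule the_equality) (use assms blinfun_eq_on_tensors in auto)

lemma op_tensor:
  assumes "A \<in> bounded_ops" "B \<in> bounded_ops"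
  shows "op_tensor t A B \<in> bounded_ops"
    and "blinfun_apply (op_tensor t A B) (t x y) = t (blinfun_apply A x) (blinfun_apply B y)"
proof -
  obtain C where "C \<in> bounded_ops"
    "\<And>x y. blinfun_apply C (t x y) = t (blinfun_apply A x) (blinfun_apply B y)"
    by (rule op_tensor_exists[OF assms]) (rule that)
  moreover from this have "op_tensor t A B = C"
    by (rule op_tensor_equality)
  ultimately show "op_tensor t A B \<in> bounded_ops"
    and "blinfun_apply (op_tensor t A B) (t x y) = t (blinfun_apply A x) (blinfun_apply B y)"
    by simp_all
qed

end

section \<open>Singular value decomposition\<close>

text \<open>Both column and row orthonormality are recorded: columns preserve a tensor expansion
  under a change of system, rows keep the new system orthonormal. Entries beyond \<open>m\<close>
  are unconstrained.\<close>

definition unitary_upto :: "nat \<Rightarrow> (nat \<Rightarrow> nat \<Rightarrow> complex) \<Rightarrow> bool"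
  where "unitary_upto m U \<longleftrightarrow>
    (\<forall>i<m. \<forall>j<m. (\<Sum>p<m. cnj (U p i) * U p j) = (if i = j then 1 else 0)) \<and>
    (\<forall>p<m. \<forall>q<m. (\<Sum>i<m. U p i * cnj (U q i)) = (if p = q then 1 else 0))"

text \<open>Entry of \<open>U N V\<close> with \<open>V\<close> transposed but not conjugated, so
  that transposing \<open>N\<close> just exchanges \<open>U\<close> and \<open>V\<close>.\<close>

definition bilinear_entry ::
    "nat \<Rightarrow> (nat \<Rightarrow> nat \<Rightarrow> complex) \<Rightarrow> (nat \<Rightarrow> nat \<Rightarrow> complex) \<Rightarrow> (nat \<Rightarrow> nat \<Rightarrow> complex) \<Rightarrow> nat \<Rightarrow> nat \<Rightarrow> complex"
  where "bilinear_entry m N U V p q = (\<Sum>i<m. \<Sum>j<m. U p i * N i j * V q j)"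

text \<open>The weights \<open>p + 1\<close> are pairwise different; a unitary pair that maximises the weighted
  trace therefore diagonalises \<open>N\<close>.\<close>

definition weighted_trace ::
    "nat \<Rightarrow> (nat \<Rightarrow> nat \<Rightarrow> complex) \<Rightarrow> (nat \<Rightarrow> nat \<Rightarrow> complex) \<Rightarrow> (nat \<Rightarrow> nat \<Rightarrow> complex) \<Rightarrow> real"
  where "weighted_trace m N U V = (\<Sum>p<m. real (Suc p) * Re (bilinear_entry m N U V p p))"

text \<open>Multiplies \<open>U\<close> from the left by a Givens rotation of rows \<open>p\<close>
  and \<open>q\<close>. The phase \<omega> gives access to both real and imaginary parts of
  off-diagonal entries.\<close>

definition plane_rotation ::
    "nat \<Rightarrow> nat \<Rightarrow> real \<Rightarrow> complex \<Rightarrow> (nat \<Rightarrow> nat \<Rightarrow> complex) \<Rightarrow> nat \<Rightarrow> nat \<Rightarrow> complex"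
  where "plane_rotation p q \<theta> \<omega> U = U(p := \<lambda>i. of_real (cos \<theta>) * U p i + \<omega> * of_real (sin \<theta>) * U q i,
    q := \<lambda>i. of_real (cos \<theta>) * U q i - cnj \<omega> * of_real (sin \<theta>) * U p i)"

lemma sum_lessThan_split2:
  fixes f :: "nat \<Rightarrow> 'a::comm_monoid_add"
  assumes "p < m" "q < m" "p \<noteq> q"
  shows "(\<Sum>r<m. f r) = f p + (f q + (\<Sum>r\<in>{..<m} - {p, q}. f r))"
proof -
  have "(\<Sum>r<m. f r) = f p + (\<Sum>r\<in>{..<m} - {p}. f r)"
    using assms by (intro sum.remove) auto
  also have "(\<Sum>r\<in>{..<m} - {p}. f r) = f q + (\<Sum>r\<in>{..<m} - {p} - {q}. f r)"
    using assms by (intro sum.remove) auto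
  also have "{..<m} - {p} - {q} = {..<m} - {p, q}"
    by blast
  finally show ?thesis .
qed

lemma cos_sin_unit_complex:
  assumes "cmod \<omega> = 1"
  shows "complex_of_real (cos \<theta>) * of_real (cos \<theta>) + \<omega> * of_real (sin \<theta>) * (cnj \<omega> * of_real (sin \<theta>)) = 1"
proof -
  have "\<omega> * cnj \<omega> = 1"
    using assms by (simp add: complex_norm_square[symmetric])
  then have "\<omega> * of_real (sin \<theta>) * (cnj \<omega> * of_real (sin \<theta>)) = of_real ((sin \<theta>)\<^sup>2)"
    by (simp add: power2_eq_square algebra_simps)
  then show ?thesis
    by (simp add: power2_eq_square[symmetric] flip: of_real_power of_real_add)
qed

lemma unitary_upto_plane_rotation:
  assumes U: "unitary_upto m U" and pq: "p < m" "q < m" "p \<noteq> q" and \<omega>: "cmod \<omega> = 1"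
  shows "unitary_upto m (plane_rotation p q \<theta> \<omega> U)"
proof -
  define R where "R = plane_rotation p q \<theta> \<omega> U"
  define c s where "c = complex_of_real (cos \<theta>)" and "s = \<omega> * complex_of_real (sin \<theta>)"
  have cs: "c * c + s * cnj s = 1" and cc: "cnj c = c"
    using cos_sin_unit_complex[OF \<omega>, of \<theta>] by (simp_all add: c_def s_def)
  have Rp: "R p i = c * U p i + s * U q i" and Rq: "R q i = c * U q i - cnj s * U p i" for i
    using pq by (simp_all add: R_def plane_rotation_def c_def s_def)
  have R: "R r = U r" if "r \<noteq> p" "r \<noteq> q" for r
    using that by (simp add: R_def plane_rotation_def)
  have "(\<Sum>r<m. cnj (R r i) * R r j) = (\<Sum>r<m. cnj (U r i) * U r j)" for i j
  proof -
    have "cnj (R p i) * R p j + cnj (R q i) * R q j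
        = (c * c + s * cnj s) * (cnj (U p i) * U p j + cnj (U q i) * U q j)"
      unfolding Rp Rq by (simp add: cc algebra_simps)
    also have "\<dots> = cnj (U p i) * U p j + cnj (U q i) * U q j"
      by (simp add: cs)
    finally have "cnj (R p i) * R p j + (cnj (R q i) * R q j + x)
        = cnj (U p i) * U p j + (cnj (U q i) * U q j + x)" for x
      by (simp add: add.assoc[symmetric])
    then show ?thesis
      unfolding sum_lessThan_split2[OF pq] by (simp add: R)
  qed
  moreover have "(\<Sum>i<m. R a i * cnj (R b i)) = (if a = b then 1 else 0)" if "a < m" "b < m" for a b
  proof -
    define G where "G = (\<lambda>a b. \<Sum>i<m. U a i * cnj (U b i))"
    have G: "G a b = (if a = b then 1 else 0)" if "a < m" "b < m" for a b
      using U that by (simp add: unitary_upto_def G_def)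
    \<comment> \<open>Covers every inner product that involves a rotated row; an untouched row
      \<open>b\<close> enters with coefficients 1 and 0.\<close>
    have lin: "(\<Sum>i<m. (\<alpha> * U a i + \<beta> * U b i) * cnj (\<gamma> * U a' i + \<delta> * U b' i))
      = \<alpha> * cnj \<gamma> * G a a' + \<alpha> * cnj \<delta> * G a b' + \<beta> * cnj \<gamma> * G b a' + \<beta> * cnj \<delta> * G b b'"
      for a b a' b' \<alpha> \<beta> \<gamma> \<delta>
      by (simp add: G_def sum_distrib_left algebra_simps sum.distrib)
    have pp: "(\<Sum>i<m. R p i * cnj (R p i)) = 1"
      unfolding Rp lin using pq cs by (simp add: G cc)
    have qq: "(\<Sum>i<m. R q i * cnj (R q i)) = 1"
      using lin[of c q "- cnj s" p c q "- cnj s" p] pq cs by (simp add: Rq G cc mult.commute)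
    have pq': "(\<Sum>i<m. R p i * cnj (R q i)) = 0"
      using lin[of c p s q "- cnj s" p c q] pq by (simp add: Rp Rq G cc algebra_simps)
    have qp': "(\<Sum>i<m. R q i * cnj (R p i)) = 0"
      using lin[of "- cnj s" p c q c p s q] pq by (simp add: Rp Rq G cc algebra_simps)
    have pr: "(\<Sum>i<m. R p i * cnj (R b i)) = 0" "(\<Sum>i<m. R q i * cnj (R b i)) = 0"
      "(\<Sum>i<m. R b i * cnj (R p i)) = 0" "(\<Sum>i<m. R b i * cnj (R q i)) = 0"
      if "b < m" "b \<noteq> p" "b \<noteq> q" for b
      using lin[of c p s q 1 b 0 b] lin[of c q "- cnj s" p 1 b 0 b]
        lin[of 1 b 0 b c p s q] lin[of 1 b 0 b c q "- cnj s" p] pq that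
      by (simp_all add: Rp Rq G R[OF that(2,3)])
    have rr: "(\<Sum>i<m. R a i * cnj (R b i)) = (if a = b then 1 else 0)"
      if "a \<noteq> p" "a \<noteq> q" "b \<noteq> p" "b \<noteq> q"
      using that G[OF \<open>a < m\<close> \<open>b < m\<close>] by (simp add: R G_def)
    consider "a = p \<or> a = q" "b = p \<or> b = q" | "a = p \<or> a = q" "b \<noteq> p" "b \<noteq> q"
      | "b = p \<or> b = q" "a \<noteq> p" "a \<noteq> q" | "a \<noteq> p" "a \<noteq> q" "b \<noteq> p" "b \<noteq> q"
      by blast
    then show ?thesis
      by cases (use pp qq pq' qp' pr rr pq that in auto)
  qed
  ultimately show ?thesis
    using U unfolding R_def unitary_upto_def by simp
qed

section \<open>Diagonalisation by maximising the weighted trace\<close>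

text \<open>The expression vanishes at \<theta> = 0, so 0 is a maximum; \<open>b\<close> is the
  derivative there.\<close>

lemma trig_maximum_at_0:
  fixes a b :: real
  assumes "\<And>\<theta>. (cos \<theta> - 1) * a + sin \<theta> * b \<le> 0"
  shows "b = 0"
proof -
  have "((\<lambda>\<theta>. (cos \<theta> - 1) * a + sin \<theta> * b) has_real_derivative b) (at 0)"
    by (auto intro!: derivative_eq_intros)
  then show ?thesis
    by (rule DERIV_local_max[of _ _ _ 1]) (use assms in auto)
qed

text \<open>First-order condition for a maximum under rotations of \<open>U\<close>: the trace
  changes by the expression of \<open>trig_maximum_at_0\<close>, whose sine coefficient must
  vanish.\<close>

lemma weighted_trace_stationary:
  assumes max: "\<And>\<theta> \<omega>. cmod \<omega> = 1 \<Longrightarrow>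
      weighted_trace m N (plane_rotation p q \<theta> \<omega> U) V \<le> weighted_trace m N U V"
    and pq: "p < m" "q < m" "p \<noteq> q"
  shows "real (Suc p) * bilinear_entry m N U V q p = real (Suc q) * cnj (bilinear_entry m N U V p q)"
proof -
  define M where "M = bilinear_entry m N U V"
  have Re: "real (Suc p) * Re (\<omega> * M q p) - real (Suc q) * Re (cnj \<omega> * M p q) = 0" if \<omega>: "cmod \<omega> = 1" for \<omega>
  proof (rule trig_maximum_at_0)
    fix \<theta>
    define R where "R = plane_rotation p q \<theta> \<omega> U"
    have p: "bilinear_entry m N R V p p = of_real (cos \<theta>) * M p p + of_real (sin \<theta>) * (\<omega> * M q p)"
      using pq by (simp add: R_def plane_rotation_def M_def bilinear_entry_def sum_distrib_left
          sum.distrib algebra_simps)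
    have q: "bilinear_entry m N R V q q = of_real (cos \<theta>) * M q q - of_real (sin \<theta>) * (cnj \<omega> * M p q)"
      using pq by (simp add: R_def plane_rotation_def M_def bilinear_entry_def sum_distrib_left
          sum.distrib sum_subtractf algebra_simps)
    have r: "bilinear_entry m N R V r r = M r r" if "r \<in> {..<m} - {p, q}" for r
      using that by (simp add: R_def plane_rotation_def M_def bilinear_entry_def)
    have "weighted_trace m N R V - weighted_trace m N U V =
      (cos \<theta> - 1) * (real (Suc p) * Re (M p p) + real (Suc q) * Re (M q q)) +
      sin \<theta> * (real (Suc p) * Re (\<omega> * M q p) - real (Suc q) * Re (cnj \<omega> * M p q))"
      unfolding weighted_trace_def sum_lessThan_split2[OF pq] p q
      by (simp add: r M_def[symmetric] algebra_simps del: of_nat_Suc)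
    then show "(cos \<theta> - 1) * (real (Suc p) * Re (M p p) + real (Suc q) * Re (M q q)) +
      sin \<theta> * (real (Suc p) * Re (\<omega> * M q p) - real (Suc q) * Re (cnj \<omega> * M p q)) \<le> 0"
      using max[OF \<omega>, of \<theta>] unfolding R_def by linarith
  qed
  \<comment> \<open>The phase 1 gives the real part of the equation, the phase \<open>\<i>\<close>
    the imaginary part.\<close>
  show ?thesis
    using Re[of 1] Re[of \<i>] unfolding M_def[symmetric]
    by (simp add: complex_eq_iff del: of_nat_Suc)
qed

lemma bilinear_entry_transpose:
  "bilinear_entry m (\<lambda>i j. N j i) V U q p = bilinear_entry m N U V p q"
  unfolding bilinear_entry_def by (subst sum.swap) (simp add: mult_ac)

lemma unitary_upto_entry_le_1:
  assumes "unitary_upto m U" "p < m" "i < m"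
  shows "cmod (U p i) \<le> 1"
proof -
  have "complex_of_real (\<Sum>j<m. (cmod (U p j))\<^sup>2) = 1"
    unfolding of_real_sum complex_norm_square using assms by (simp add: unitary_upto_def)
  then have "(\<Sum>j<m. (cmod (U p j))\<^sup>2) = 1"
    using of_real_eq_1_iff by blast
  then have "(cmod (U p i))\<^sup>2 \<le> 1"
    using member_le_sum[of i "{..<m}" "\<lambda>j. (cmod (U p j))\<^sup>2"] assms(3) by simp
  then show ?thesis
    by (simp add: abs_square_le_1)
qed

text \<open>Compactness: a product of closed unit discs is compact, unitarity is a closed condition
  and the weighted trace is continuous.\<close>

lemma weighted_trace_attains_max:
  obtains U V where "unitary_upto m U" "unitary_upto m V"
    "\<And>U' V'. unitary_upto m U' \<Longrightarrow> unitary_upto m V' \<Longrightarrow> weighted_trace m N U' V' \<le> weighted_trace m N U V"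
proof -
  \<comment> \<open>The pair \<open>U\<close>, \<open>V\<close> is encoded as one function so that a
    single product space suffices; the boolean selects the matrix.\<close>
  define row where "row = (\<lambda>b (W :: bool \<times> nat \<times> nat \<Rightarrow> complex) p i. W (b, p, i))"
  define K where "K = {W. (\<forall>x. W x \<in> cball 0 1) \<and> unitary_upto m (row True W) \<and> unitary_upto m (row False W)}"
  have cont: "continuous_on UNIV (\<lambda>W. row b W p i)" for b p i
    unfolding row_def by (rule continuous_on_product_coordinates)
  have "compact (PiE UNIV (\<lambda>x :: bool \<times> nat \<times> nat. cball (0::complex) 1))"
    using compactin_PiE[of "\<lambda>_. euclidean" UNIV "\<lambda>_ :: bool \<times> nat \<times> nat. cball (0::complex) 1"]
    by (simp add: euclidean_product_topology)
  moreover have "closed {W. unitary_upto m (row b W)}" for b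
    unfolding unitary_upto_def
    by (intro closed_Collect_conj closed_Collect_all closed_Collect_imp closed_Collect_eq
        continuous_intros cont) auto
  ultimately have "compact (PiE UNIV (\<lambda>x. cball 0 1) \<inter> ({W. unitary_upto m (row True W)} \<inter> {W. unitary_upto m (row False W)}))"
    by (intro compact_Int_closed closed_Int)
  also have "\<dots> = K"
    by (auto simp: K_def PiE_def)
  finally have "compact K" .
  \<comment> \<open>Zeroing the entries outside the first \<open>m\<close> indices puts any unitary
    pair into \<open>K\<close>, and neither unitarity nor the trace sees those entries.\<close>
  define trunc where "trunc = (\<lambda>U V (b, p, i). if p < m \<and> i < m then (if b then U p i else V p i) else (0::complex))"
  have trunc: "trunc U V \<in> K" "weighted_trace m N (row True (trunc U V)) (row False (trunc U V)) = weighted_trace m N U V"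
    if "unitary_upto m U" "unitary_upto m V" for U V
    using that unitary_upto_entry_le_1[OF that(1)] unitary_upto_entry_le_1[OF that(2)]
    by (auto simp: K_def trunc_def row_def unitary_upto_def weighted_trace_def bilinear_entry_def)
  have "unitary_upto m (\<lambda>p i. if p = i then 1 else 0)"
  proof -
    have "cnj (if P then 1 else 0) = (if P then 1 else 0)" for P
      by simp
    then show ?thesis
      by (simp add: unitary_upto_def mult_if_delta)
  qed
  then have "K \<noteq> {}"
    using trunc(1) by blast
  moreover have "continuous_on K (\<lambda>W. weighted_trace m N (row True W) (row False W))"
    unfolding weighted_trace_def bilinear_entry_def
    by (intro continuous_intros continuous_on_subset[OF cont]) auto
  ultimately obtain W where W: "W \<in> K" "\<And>W'. W' \<in> K \<Longrightarrow>
      weighted_trace m N (row True W') (row False W') \<le> weighted_trace m N (row True W) (row False W)"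
    using continuous_attains_sup[OF \<open>compact K\<close>] by blast
  show ?thesis
  proof (rule that)
    show "unitary_upto m (row True W)" "unitary_upto m (row False W)"
      using W(1) by (simp_all add: K_def)
    show "weighted_trace m N U' V' \<le> weighted_trace m N (row True W) (row False W)"
      if "unitary_upto m U'" "unitary_upto m V'" for U' V'
      using W(2)[OF trunc(1)[OF that]] trunc(2)[OF that] by simp
  qed
qed

text \<open>At a maximum, stationarity in \<open>U\<close> and in \<open>V\<close> links the entries
  at \<open>(p, q)\<close> and \<open>(q, p)\<close> twice. Eliminating one leaves the other
  multiplied by a difference of squares of distinct weights.\<close>

lemma singular_value_decomposition:
  obtains U V where "unitary_upto m U" "unitary_upto m V"
    "\<And>p q. p < m \<Longrightarrow> q < m \<Longrightarrow> p \<noteq> q \<Longrightarrow> bilinear_entry m N U V p q = 0"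
proof -
  obtain U V where U: "unitary_upto m U" and V: "unitary_upto m V" and
    max: "\<And>U' V'. unitary_upto m U' \<Longrightarrow> unitary_upto m V' \<Longrightarrow> weighted_trace m N U' V' \<le> weighted_trace m N U V"
    by (rule weighted_trace_attains_max[of m N]) (rule that)
  have swap: "weighted_trace m (\<lambda>i j. N j i) V' U' = weighted_trace m N U' V'" for U' V'
    by (simp only: weighted_trace_def bilinear_entry_transpose[of m N])
  have "bilinear_entry m N U V p q = 0" if pq: "p < m" "q < m" "p \<noteq> q" for p q
  proof -
    let ?M = "bilinear_entry m N U V"
    have 1: "real (Suc p) * ?M q p = real (Suc q) * cnj (?M p q)"
      by (rule weighted_trace_stationary[OF max[OF unitary_upto_plane_rotation[OF U pq] V] pq])
    \<comment> \<open>Stationarity in \<open>V\<close> is stationarity in the first matrix for the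
      transpose of \<open>N\<close>.\<close>
    have 2: "real (Suc p) * ?M p q = real (Suc q) * cnj (?M q p)"
      by (rule weighted_trace_stationary[OF _ pq, of "\<lambda>i j. N j i" V U,
            unfolded swap bilinear_entry_transpose[of m N]])
        (rule max[OF U unitary_upto_plane_rotation[OF V pq]])
    have "real (Suc p) * (real (Suc p) * ?M p q) = real (Suc q) * cnj (real (Suc p) * ?M q p)"
      unfolding 2 by simp
    also have "\<dots> = real (Suc q) * (real (Suc q) * ?M p q)"
      unfolding 1 by simp
    finally have "((real (Suc p))\<^sup>2 - (real (Suc q))\<^sup>2) * ?M p q = 0"
      by (simp add: power2_eq_square algebra_simps)
    moreover have "(real (Suc p))\<^sup>2 \<noteq> (real (Suc q))\<^sup>2"
      using pq(3) by (simp add: power2_eq_iff_nonneg)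
    ultimately show ?thesis
      by (simp only: of_real_eq_0_iff mult_eq_0_iff) (metis eq_iff_diff_eq_0 of_real_eq_0_iff)
  qed
  from that[OF U V this] show ?thesis .
qed

section \<open>Scalar estimates\<close>

definition sesquilinear :: "('a::chilbert_space \<Rightarrow> 'a \<Rightarrow> complex) \<Rightarrow> bool"
  where "sesquilinear a \<longleftrightarrow>
    (\<forall>x y z. a (x + y) z = a x z + a y z) \<and> (\<forall>x y z. a x (y + z) = a x y + a x z) \<and>
    (\<forall>c x y. a (c *\<^sub>C x) y = c * a x y) \<and> (\<forall>c x y. a x (c *\<^sub>C y) = cnj c * a x y)"

lemma sesquilinear_combination:
  assumes "sesquilinear a"
  shows "a (c *\<^sub>C p + d *\<^sub>C p') (c' *\<^sub>C q + d' *\<^sub>C q')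
    = c * cnj c' * a p q + c * cnj d' * a p q' + d * cnj c' * a p' q + d * cnj d' * a p' q'"
  using assms unfolding sesquilinear_def by (simp add: algebra_simps)

lemma sesquilinear_zero:
  assumes "sesquilinear a"
  shows "a 0 y = 0" "a x 0 = 0"
  using sesquilinear_combination[OF assms, of 0 0 0 0 1 y 0 0]
    sesquilinear_combination[OF assms, of 1 x 0 0 0 0 0 0]
  by (simp_all add: scaleC_one)

text \<open>The same 2 by 2 unitary matrix acts on \<open>(p, p')\<close> and
  \<open>(q, q')\<close>, which leaves the functional \<open>a \<mapsto> a p q + a p' q'\<close>
  unchanged.\<close>

lemma sesquilinear_rotation_sum:
  assumes "sesquilinear a" and c: "c * cnj c + d * cnj d = 1"
  shows "a (c *\<^sub>C p + d *\<^sub>C p') (c *\<^sub>C q + d *\<^sub>C q')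
      + a ((- cnj d) *\<^sub>C p + cnj c *\<^sub>C p') ((- cnj d) *\<^sub>C q + cnj c *\<^sub>C q') = a p q + a p' q'"
proof -
  have "a (c *\<^sub>C p + d *\<^sub>C p') (c *\<^sub>C q + d *\<^sub>C q')
      + a ((- cnj d) *\<^sub>C p + cnj c *\<^sub>C p') ((- cnj d) *\<^sub>C q + cnj c *\<^sub>C q')
      = (c * cnj c + d * cnj d) * (a p q + a p' q')"
    unfolding sesquilinear_combination[OF assms(1)] by (simp add: algebra_simps)
  then show ?thesis
    by (simp add: c)
qed

lemma sesquilinear_cinner: "sesquilinear cinner"
  by (simp add: sesquilinear_def cinner_simps)

text \<open>The form of a 2 by 2 matrix with diagonal \<open>s, -s\<close> vanishes at some unit
  vector. After division by \<open>s\<close>, a phase makes the off-diagonal contribution real, and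
  the intermediate value theorem finds the angle.\<close>

lemma trace_zero_numerical_range:
  fixes s u v :: complex
  obtains c d where "c * cnj c + d * cnj d = 1"
    "c * cnj c * s + c * cnj d * u + d * cnj c * v - d * cnj d * s = 0"
proof (cases "s = 0")
  case True
  with that[of 1 0] show ?thesis
    by simp
next
  case False
  define \<delta> where "\<delta> = v / s - cnj (u / s)"
  \<comment> \<open>Chosen so that \<open>\<omega> * \<delta>\<close> is the modulus of \<delta>,
    hence real; this is exactly what makes
    \<open>cnj \<omega> * (u / s) + \<omega> * (v / s)\<close> real.\<close>
  define \<omega> where "\<omega> = (if \<delta> = 0 then 1 else cnj (sgn \<delta>))"
  have \<omega>: "\<omega> * cnj \<omega> = 1"
    by (simp add: \<omega>_def norm_sgn flip: complex_norm_square)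
  have "\<omega> * \<delta> = of_real (cmod \<delta>)"
  proof (cases "\<delta> = 0")
    case False
    have "cnj (sgn \<delta>) * \<delta> = cnj \<delta> * \<delta> / of_real (cmod \<delta>)"
      by (simp add: sgn_div_norm scaleR_conv_of_real divide_inverse mult.commute)
    also have "cnj \<delta> * \<delta> = (of_real (cmod \<delta>))\<^sup>2"
      by (subst mult.commute) (simp flip: complex_norm_square)
    finally show ?thesis
      using False by (simp add: \<omega>_def power2_eq_square)
  qed simp
  then have "Im (\<omega> * \<delta>) = 0"
    by simp
  moreover have "Im (cnj \<omega> * x + \<omega> * y) = Im (\<omega> * (y - cnj x))" for x y
    by (simp add: algebra_simps)
  ultimately have "Im (cnj \<omega> * (u / s) + \<omega> * (v / s)) = 0"
    by (simp only: \<delta>_def)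
  then have "cnj \<omega> * (u / s) + \<omega> * (v / s) \<in> \<real>"
    by (simp only: complex_is_Real_iff)
  then obtain w where w: "cnj \<omega> * (u / s) + \<omega> * (v / s) = complex_of_real w"
    by (rule Reals_cases)
  define \<phi> where "\<phi> = (\<lambda>\<theta>. (cos \<theta>)\<^sup>2 + cos \<theta> * sin \<theta> * w - (sin \<theta>)\<^sup>2)"
  have "\<exists>\<theta>\<ge>0. \<theta> \<le> pi / 2 \<and> \<phi> \<theta> = 0"
    by (rule IVT2') (auto simp: \<phi>_def intro!: continuous_intros)
  then obtain \<theta> where \<theta>: "\<phi> \<theta> = 0"
    by blast
  define c d where "c = complex_of_real (cos \<theta>)" and "d = of_real (sin \<theta>) * \<omega>"
  have cc: "c * cnj c = of_real ((cos \<theta>)\<^sup>2)" and dd: "d * cnj d = of_real ((sin \<theta>)\<^sup>2)"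
    using \<omega> by (simp_all add: c_def d_def power2_eq_square mult_ac)
  show ?thesis
  proof (rule that)
    show "c * cnj c + d * cnj d = 1"
      unfolding cc dd of_real_add[symmetric] by simp
    have "c * cnj d * (u / s) + d * cnj c * (v / s)
        = of_real (cos \<theta> * sin \<theta>) * (cnj \<omega> * (u / s) + \<omega> * (v / s))"
      by (simp add: c_def d_def algebra_simps)
    then have "c * cnj c + (c * cnj d * (u / s) + d * cnj c * (v / s)) - d * cnj d = of_real (\<phi> \<theta>)"
      unfolding cc dd w by (simp add: \<phi>_def)
    then have "s * (c * cnj c + (c * cnj d * (u / s) + d * cnj c * (v / s)) - d * cnj d) = 0"
      by (simp add: \<theta>)
    then show "c * cnj c * s + c * cnj d * u + d * cnj c * v - d * cnj d * s = 0"
      using False by (simp add: algebra_simps)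
  qed
qed

text \<open>A functional of rank two that annihilates \<open>\<tau>\<close> is a sum of two rank-one functionals that
  annihilate \<open>\<tau>\<close>, because a trace-zero matrix is unitarily equivalent to one with zero diagonal.\<close>

lemma rank_two_bound:
  fixes a \<tau> :: "'a::chilbert_space \<Rightarrow> 'a \<Rightarrow> complex"
  assumes a: "sesquilinear a" and \<tau>: "sesquilinear \<tau>" and b: "0 \<le> b"
    and bound: "\<And>y z. \<tau> y z = 0 \<Longrightarrow> cmod (a y z) \<le> b * (norm y * norm z)"
    and trace: "\<tau> p q + \<tau> p' q' = 0"
  shows "cmod (a p q + a p' q') \<le> b * (((norm p)\<^sup>2 + (norm p')\<^sup>2 + (norm q)\<^sup>2 + (norm q')\<^sup>2) / 2)"
proof -
  obtain c d where cd: "c * cnj c + d * cnj d = 1"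
    "c * cnj c * \<tau> p q + c * cnj d * \<tau> p q' + d * cnj c * \<tau> p' q - d * cnj d * \<tau> p q = 0"
    by (rule trace_zero_numerical_range)
  define r where "r = (\<lambda>x x' :: 'a. c *\<^sub>C x + d *\<^sub>C x')"
  define r' where "r' = (\<lambda>x x' :: 'a. (- cnj d) *\<^sub>C x + cnj c *\<^sub>C x')"
  have rot: "f (r p p') (r q q') + f (r' p p') (r' q q') = f p q + f p' q'" if "sesquilinear f" for f p p' q q'
    unfolding r_def r'_def by (rule sesquilinear_rotation_sum[OF that cd(1)])
  have norms: "(norm (r x x'))\<^sup>2 + (norm (r' x x'))\<^sup>2 = (norm x)\<^sup>2 + (norm x')\<^sup>2" for x x'
    using rot[OF sesquilinear_cinner, of x x' x x'] unfolding cinner_self of_real_add[symmetric] of_real_eq_iff .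
  have "\<tau> p' q' = - \<tau> p q"
    using trace by (simp add: eq_neg_iff_add_eq_0 add.commute)
  then have 1: "\<tau> (r p p') (r q q') = 0"
    using cd(2) unfolding r_def sesquilinear_combination[OF \<tau>] by simp
  \<comment> \<open>The rotation preserves the sum of the two values of \<tau>, which is zero, so
    the second value vanishes with the first.\<close>
  then have 2: "\<tau> (r' p p') (r' q q') = 0"
    using rot[OF \<tau>, of p p' q q'] trace by simp
  have young: "b * (norm x * norm y) \<le> b * (((norm x)\<^sup>2 + (norm y)\<^sup>2) / 2)" for x y :: 'a
    using sum_squares_bound[of "norm x" "norm y"] b by (intro mult_left_mono) auto
  have "cmod (a p q + a p' q') \<le> cmod (a (r p p') (r q q')) + cmod (a (r' p p') (r' q q'))"
    using norm_triangle_ineq[of "a (r p p') (r q q')" "a (r' p p') (r' q q')"] by (simp only: rot[OF a])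
  also have "\<dots> \<le> b * (((norm (r p p'))\<^sup>2 + (norm (r q q'))\<^sup>2) / 2)
      + b * (((norm (r' p p'))\<^sup>2 + (norm (r' q q'))\<^sup>2) / 2)"
    by (intro add_mono order_trans[OF bound[OF 1] young] order_trans[OF bound[OF 2] young])
  also have "\<dots> = b * ((((norm (r p p'))\<^sup>2 + (norm (r' p p'))\<^sup>2) + ((norm (r q q'))\<^sup>2 + (norm (r' q q'))\<^sup>2)) / 2)"
    by (simp add: field_simps)
  also have "\<dots> = b * (((norm p)\<^sup>2 + (norm p')\<^sup>2 + (norm q)\<^sup>2 + (norm q')\<^sup>2) / 2)"
    unfolding norms by (simp add: add.assoc)
  finally show ?thesis .
qed

text \<open>Since \<open>\<tau> h g = 1\<close>, correcting \<open>(y, z)\<close> by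
  \<open>- \<tau> y z\<close> times \<open>(h, g)\<close> gives a functional of rank two that
  annihilates \<tau>, and \<open>rank_two_bound\<close> applies.\<close>

lemma linear_selection_bound:
  fixes a \<tau> :: "'a::chilbert_space \<Rightarrow> 'a \<Rightarrow> complex"
  assumes a: "sesquilinear a" and \<tau>: "sesquilinear \<tau>" and b: "0 \<le> b"
    and bound: "\<And>y z. \<tau> y z = 0 \<Longrightarrow> cmod (a y z) \<le> b * (norm y * norm z)"
    and \<tau>_bound: "\<And>y z. cmod (\<tau> y z) \<le> K * (norm y * norm z)"
    and h: "norm h = 1" and hg: "\<tau> h g = 1"
  shows "cmod (a y z - \<tau> y z * a h g) \<le> b * (1 + K * norm g) * (norm y * norm z)"
proof -
  have unit: "cmod (a y z - \<tau> y z * a h g) \<le> b * (1 + K * norm g)" if "norm y = 1" "norm z = 1" for y z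
  proof -
    define s r where "s = \<tau> y z" and "r = sqrt (cmod s * norm g)"
    have g: "g \<noteq> 0"
      using hg \<tau>_bound[of h 0] by auto
    have r2: "r\<^sup>2 = cmod s * norm g"
      by (simp add: r_def)
    \<comment> \<open>The factor \<open>- s\<close> is distributed so that neither \<open>p\<close>
      nor \<open>q\<close> exceeds \<open>r\<close> in norm; the mean of squares in
      \<open>rank_two_bound\<close> then costs only \<open>cmod s * norm g\<close>.\<close>
    define p where "p = (sgn s * of_real r) *\<^sub>C h"
    define q where "q = of_real (- r / norm g) *\<^sub>C g"
    have pq: "f p q = - s * f h g" if "sesquilinear f" for f
    proof -
      have "f p q = sgn s * of_real r * cnj (of_real (- r / norm g)) * f h g"
        using that unfolding sesquilinear_def p_def q_def by (metis mult.assoc)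
      also have "sgn s * of_real r * cnj (of_real (- r / norm g)) = sgn s * of_real (- r\<^sup>2 / norm g)"
        by (simp add: power2_eq_square)
      also have "- r\<^sup>2 / norm g = - cmod s"
        using g by (simp add: r2)
      also have "sgn s * of_real (- cmod s) = - s"
        by (simp add: sgn_eq)
      finally show ?thesis .
    qed
    have "r \<ge> 0"
      by (simp add: r_def)
    then have "norm p \<le> r" "norm q = r"
      using g h by (auto simp: p_def q_def norm_scaleC norm_mult norm_sgn norm_divide)
    then have "(norm p)\<^sup>2 \<le> cmod s * norm g" "(norm q)\<^sup>2 = cmod s * norm g"
      using r2 power_mono[of "norm p" r 2] by auto
    then have "((norm y)\<^sup>2 + (norm p)\<^sup>2 + (norm z)\<^sup>2 + (norm q)\<^sup>2) / 2 \<le> 1 + cmod s * norm g"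
      using that by (simp add: mult.commute)
    also have "\<dots> \<le> 1 + K * norm g"
      using \<tau>_bound[of y z] that by (simp add: s_def mult_right_mono)
    finally have "b * (((norm y)\<^sup>2 + (norm p)\<^sup>2 + (norm z)\<^sup>2 + (norm q)\<^sup>2) / 2) \<le> b * (1 + K * norm g)"
      using b by (rule mult_left_mono)
    moreover have "cmod (a y z + a p q) \<le> b * (((norm y)\<^sup>2 + (norm p)\<^sup>2 + (norm z)\<^sup>2 + (norm q)\<^sup>2) / 2)"
      by (rule rank_two_bound[OF a \<tau> b bound]) (simp_all add: pq[OF \<tau>] hg s_def)
    ultimately show ?thesis
      by (simp add: pq[OF a] s_def)
  qed
  show ?thesis
  proof (cases "y = 0 \<or> z = 0")
    case True
    then show ?thesis
      using sesquilinear_zero[OF a] sesquilinear_zero[OF \<tau>] by auto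
  next
    case False
    define y' z' where "y' = of_real (inverse (norm y)) *\<^sub>C y" and "z' = of_real (inverse (norm z)) *\<^sub>C z"
    have n: "norm y' = 1" "norm z' = 1"
      using False by (simp_all add: y'_def z'_def norm_scaleC norm_inverse)
    have f': "f y' z' = of_real (inverse (norm y * norm z)) * f y z" if "sesquilinear f" for f
      using that by (simp add: sesquilinear_def y'_def z'_def)
    have "a y' z' - \<tau> y' z' * a h g = of_real (inverse (norm y * norm z)) * (a y z - \<tau> y z * a h g)"
      unfolding f'[OF a] f'[OF \<tau>] by (simp only: right_diff_distrib mult.assoc)
    then have "inverse (norm y * norm z) * cmod (a y z - \<tau> y z * a h g) \<le> b * (1 + K * norm g)"
      using unit[OF n] by (simp add: norm_mult norm_inverse)
    then show ?thesis
      using False by (simp add: field_simps)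
  qed
qed

section \<open>Averaging over subsets\<close>

text \<open>Membership of \<open>p\<close> and \<open>q\<close> is prescribed and all other elements
  are free, so a quarter of all subsets qualify.\<close>

lemma card_separating_subsets:
  assumes "finite I" "p \<in> I" "q \<in> I" "p \<noteq> q"
  shows "4 * card {X \<in> Pow I. p \<in> X \<and> q \<notin> X} = 2 ^ card I"
proof -
  have "{X \<in> Pow I. p \<in> X \<and> q \<notin> X} = insert p ` Pow (I - {p, q})"
  proof (intro equalityI subsetI)
    fix X assume "X \<in> {X \<in> Pow I. p \<in> X \<and> q \<notin> X}"
    then show "X \<in> insert p ` Pow (I - {p, q})"
      by (intro image_eqI[of _ _ "X - {p}"]) auto
  qed (use assms in auto)
  moreover have "inj_on (insert p) (Pow (I - {p, q}))"
    by (auto simp: inj_on_def)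
  ultimately have "card {X \<in> Pow I. p \<in> X \<and> q \<notin> X} = 2 ^ card (I - {p, q})"
    using assms(1) by (simp add: card_image card_Pow)
  moreover have "card I = Suc (Suc (card (I - {p, q})))"
    using assms by (metis card_Suc_Diff1 Diff_insert finite_Diff insert_Diff insert_iff)
  ultimately show ?thesis
    by simp
qed

text \<open>Complementation pairs the subsets, so each element is counted in half of them.\<close>

lemma sum_subsets_and_complements:
  fixes u v :: "'i \<Rightarrow> real"
  assumes "finite I"
  shows "2 * (\<Sum>X\<in>Pow I. (\<Sum>p\<in>X. u p) + (\<Sum>q\<in>I - X. v q)) = 2 ^ card I * ((\<Sum>p\<in>I. u p) + (\<Sum>q\<in>I. v q))"
proof -
  have compl: "(\<Sum>X\<in>Pow I. f (I - X)) = (\<Sum>X\<in>Pow I. f X)" for f :: "'i set \<Rightarrow> real"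
    by (rule sum.reindex_bij_witness[of _ "\<lambda>X. I - X" "\<lambda>X. I - X"]) auto
  have half: "2 * (\<Sum>X\<in>Pow I. \<Sum>p\<in>X. f p) = 2 ^ card I * (\<Sum>p\<in>I. f p)" for f :: "'i \<Rightarrow> real"
  proof -
    have "2 * (\<Sum>X\<in>Pow I. \<Sum>p\<in>X. f p) = (\<Sum>X\<in>Pow I. \<Sum>p\<in>X. f p) + (\<Sum>X\<in>Pow I. \<Sum>p\<in>I - X. f p)"
      using compl[of "sum f"] by simp
    also have "\<dots> = (\<Sum>X\<in>Pow I. \<Sum>p\<in>I. f p)"
      unfolding sum.distrib[symmetric] using assms
      by (intro sum.cong refl) (simp add: sum.subset_diff[of _ I] add.commute)
    finally show ?thesis
      using assms by (simp add: card_Pow)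
  qed
  have "2 * (\<Sum>X\<in>Pow I. (\<Sum>p\<in>X. u p) + (\<Sum>q\<in>I - X. v q))
      = 2 * (\<Sum>X\<in>Pow I. \<Sum>p\<in>X. u p) + 2 * (\<Sum>X\<in>Pow I. \<Sum>q\<in>X. v q)"
    using compl[of "sum v"] by (simp add: sum.distrib)
  then show ?thesis
    by (simp only: half distrib_left)
qed

text \<open>Summed over all \<open>X\<close>, the blocks from \<open>X\<close> to its complement
  count each off-diagonal pair in a quarter of the cases, while the bounds count each weight in half
  of them. Together with the factor 1/2 in \<open>bound\<close>, the constant is 1.\<close>

lemma off_diagonal_bound:
  fixes a :: "'i \<Rightarrow> 'i \<Rightarrow> complex" and u v :: "'i \<Rightarrow> real"
  assumes fin: "finite I"
    and bound: "\<And>X. X \<subseteq> I \<Longrightarrow>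
      cmod (\<Sum>p\<in>X. \<Sum>q\<in>I - X. a p q) \<le> b * (((\<Sum>p\<in>X. u p) + (\<Sum>q\<in>I - X. v q)) / 2)"
  shows "cmod (\<Sum>p\<in>I. \<Sum>q\<in>I - {p}. a p q) \<le> b * ((\<Sum>p\<in>I. u p) + (\<Sum>q\<in>I. v q))"
proof -
  define S where "S = (\<Sum>p\<in>I. \<Sum>q\<in>I - {p}. a p q)"
  have "(\<Sum>X\<in>Pow I. \<Sum>p\<in>X. \<Sum>q\<in>I - X. a p q)
      = (\<Sum>X\<in>Pow I. \<Sum>p\<in>I. \<Sum>q\<in>I - {p}. if p \<in> X \<and> q \<notin> X then a p q else 0)"
  proof (rule sum.cong[OF refl])
    fix X assume X: "X \<in> Pow I"
    have "(\<Sum>p\<in>X. \<Sum>q\<in>I - X. a p q) = (\<Sum>p\<in>X. \<Sum>q\<in>I - {p}. if p \<in> X \<and> q \<notin> X then a p q else 0)"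
      using fin by (intro sum.cong refl sum.mono_neutral_cong_left) auto
    also have "\<dots> = (\<Sum>p\<in>I. \<Sum>q\<in>I - {p}. if p \<in> X \<and> q \<notin> X then a p q else 0)"
      using fin X by (intro sum.mono_neutral_left) auto
    finally show "(\<Sum>p\<in>X. \<Sum>q\<in>I - X. a p q)
      = (\<Sum>p\<in>I. \<Sum>q\<in>I - {p}. if p \<in> X \<and> q \<notin> X then a p q else 0)" .
  qed
  also have "\<dots> = (\<Sum>p\<in>I. \<Sum>q\<in>I - {p}. \<Sum>X\<in>Pow I. if p \<in> X \<and> q \<notin> X then a p q else 0)"
    by (subst sum.swap, intro sum.cong refl, rule sum.swap)
  also have "\<dots> = (\<Sum>p\<in>I. \<Sum>q\<in>I - {p}. of_nat (card {X \<in> Pow I. p \<in> X \<and> q \<notin> X}) * a p q)"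
    using fin by (intro sum.cong refl) (simp add: sum.inter_filter[symmetric])
  finally have "4 * (\<Sum>X\<in>Pow I. \<Sum>p\<in>X. \<Sum>q\<in>I - X. a p q)
      = (\<Sum>p\<in>I. \<Sum>q\<in>I - {p}. of_nat (4 * card {X \<in> Pow I. p \<in> X \<and> q \<notin> X}) * a p q)"
    by (simp add: sum_distrib_left mult.assoc)
  also have "\<dots> = 2 ^ card I * S"
    unfolding S_def sum_distrib_left
    by (intro sum.cong refl, subst card_separating_subsets) (use fin in auto)
  finally have "2 ^ card I * cmod S = 4 * cmod (\<Sum>X\<in>Pow I. \<Sum>p\<in>X. \<Sum>q\<in>I - X. a p q)"
    by (metis norm_mult norm_numeral norm_power)
  also have "\<dots> \<le> 4 * (\<Sum>X\<in>Pow I. b * (((\<Sum>p\<in>X. u p) + (\<Sum>q\<in>I - X. v q)) / 2))"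
    using bound by (intro mult_left_mono sum_norm_le) auto
  also have "\<dots> = b * (2 * (\<Sum>X\<in>Pow I. (\<Sum>p\<in>X. u p) + (\<Sum>q\<in>I - X. v q)))"
    unfolding sum_distrib_left by (intro sum.cong refl) simp
  also have "\<dots> = 2 ^ card I * (b * ((\<Sum>p\<in>I. u p) + (\<Sum>q\<in>I. v q)))"
    unfolding sum_subsets_and_complements[OF fin] by simp
  finally show ?thesis
    by (simp add: S_def)
qed

section \<open>The tensor product of a line with all operators\<close>

lemma unitary_upto_cnj: "unitary_upto m U \<Longrightarrow> unitary_upto m (\<lambda>p i. cnj (U p i))"
  unfolding unitary_upto_def by (simp add: mult.commute)

context hilbert_tensor
begin

section \<open>Diagonalising expansions\<close>

lemma unitary_change_of_expansion:
  assumes U: "unitary_upto m U" and e: "orthonormal_on {..<m} e"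
  shows "(\<Sum>p<m. t (\<Sum>i<m. U p i *\<^sub>C u i) (\<Sum>j<m. cnj (U p j) *\<^sub>C e j)) = (\<Sum>i<m. t (u i) (e i))"
    and "orthonormal_on {..<m} (\<lambda>p. \<Sum>j<m. cnj (U p j) *\<^sub>C e j)"
proof -
  have "(\<Sum>p<m. t (\<Sum>i<m. U p i *\<^sub>C u i) (\<Sum>j<m. cnj (U p j) *\<^sub>C e j))
      = (\<Sum>p<m. \<Sum>i<m. \<Sum>j<m. (cnj (U p j) * U p i) *\<^sub>C t (u i) (e j))"
    by (simp only: tensor_sum_left) (simp add: tensor_sum_right tensor_scaleC_left
        tensor_scaleC_right scaleC_scaleC complex_vector.scale_sum_right mult.commute)
  also have "\<dots> = (\<Sum>i<m. \<Sum>j<m. \<Sum>p<m. (cnj (U p j) * U p i) *\<^sub>C t (u i) (e j))"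
    by (rule trans[OF sum.swap], rule sum.cong[OF refl], rule sum.swap)
  also have "\<dots> = (\<Sum>i<m. \<Sum>j<m. (if j = i then 1 else 0) *\<^sub>C t (u i) (e j))"
    using U by (intro sum.cong refl)
      (simp add: unitary_upto_def complex_vector.scale_sum_left[symmetric])
  also have "\<dots> = (\<Sum>i<m. \<Sum>j<m. if j = i then t (u i) (e j) else 0)"
    by (intro sum.cong refl) (simp add: scaleC_one)
  finally show "(\<Sum>p<m. t (\<Sum>i<m. U p i *\<^sub>C u i) (\<Sum>j<m. cnj (U p j) *\<^sub>C e j)) = (\<Sum>i<m. t (u i) (e i))"
    by simp
next
  show "orthonormal_on {..<m} (\<lambda>p. \<Sum>j<m. cnj (U p j) *\<^sub>C e j)"
    unfolding orthonormal_on_def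
  proof (intro ballI)
    fix p q assume pq: "p \<in> {..<m}" "q \<in> {..<m}"
    have "cinner (\<Sum>j<m. cnj (U p j) *\<^sub>C e j) (\<Sum>j<m. cnj (U q j) *\<^sub>C e j)
        = (\<Sum>i<m. \<Sum>j<m. if j = i then cnj (U p i) * U q j else 0)"
      unfolding cinner_sum_left unfolding cinner_sum_right using e
      by (intro sum.cong refl) (simp add: cinner_scaleC_left cinner_scaleC_right orthonormal_on_def)
    also have "\<dots> = (\<Sum>i<m. U q i * cnj (U p i))"
      by (simp add: mult.commute)
    finally show "cinner (\<Sum>j<m. cnj (U p j) *\<^sub>C e j) (\<Sum>j<m. cnj (U q j) *\<^sub>C e j) = (if p = q then 1 else 0)"
      using U pq by (simp add: unitary_upto_def)
  qed
qed

lemma blinfun_bounded_ops_sum: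
  assumes "A \<in> bounded_ops"
  shows "blinfun_apply A (\<Sum>i\<in>I. c i *\<^sub>C x i) = (\<Sum>i\<in>I. c i *\<^sub>C blinfun_apply A (x i))"
  using assms by (simp add: blinfun.sum_right bounded_ops_def)

text \<open>A common system gives a square matrix \<open>N\<close>; its singular value decomposition
  changes the systems of \<open>y\<close> and \<open>z\<close> separately.\<close>

lemma diagonalising_expansions:
  assumes T: "T \<in> bounded_ops" and "y \<in> alg_tensor" "z \<in> alg_tensor"
  obtains m f f' u v where "orthonormal_on {..<m::nat} f" "orthonormal_on {..<m} f'"
    "y = (\<Sum>p<m. t (u p) (f p))" "z = (\<Sum>p<m. t (v p) (f' p))"
    "\<And>p q. p < m \<Longrightarrow> q < m \<Longrightarrow> p \<noteq> q \<Longrightarrow> cinner (blinfun_apply T (u p)) (v q) = 0"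
proof -
  obtain e :: "nat \<Rightarrow> 'k" and m u v where e: "orthonormal_on {..<m} e"
    and y: "y = (\<Sum>i<m. t (u i) (e i))" and z: "z = (\<Sum>i<m. t (v i) (e i))"
    by (rule common_orthonormal_expansion[OF assms(2,3)])
  define N where "N = (\<lambda>i j. cinner (blinfun_apply T (u i)) (v j))"
  obtain U V where U: "unitary_upto m U" and V: "unitary_upto m V"
    and diag: "\<And>p q. p < m \<Longrightarrow> q < m \<Longrightarrow> p \<noteq> q \<Longrightarrow> bilinear_entry m N U V p q = 0"
    by (rule singular_value_decomposition[of m N]) (rule that)
  define u' where "u' = (\<lambda>p. \<Sum>i<m. U p i *\<^sub>C u i)"
  \<comment> \<open>The conjugate cancels the conjugate-linearity of the second argument, so the new
    matrix is the one described by \<open>bilinear_entry\<close>.\<close>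
  define v' where "v' = (\<lambda>p. \<Sum>i<m. cnj (V p i) *\<^sub>C v i)"
  show ?thesis
  proof (rule that)
    show "orthonormal_on {..<m} (\<lambda>p. \<Sum>j<m. cnj (U p j) *\<^sub>C e j)"
      by (rule unitary_change_of_expansion[OF U e])
    show "y = (\<Sum>p<m. t (u' p) (\<Sum>j<m. cnj (U p j) *\<^sub>C e j))"
      unfolding u'_def y by (rule unitary_change_of_expansion(1)[OF U e, symmetric])
    show "orthonormal_on {..<m} (\<lambda>p. \<Sum>j<m. cnj (cnj (V p j)) *\<^sub>C e j)"
      by (rule unitary_change_of_expansion[OF unitary_upto_cnj[OF V] e])
    show "z = (\<Sum>p<m. t (v' p) (\<Sum>j<m. cnj (cnj (V p j)) *\<^sub>C e j))"
      unfolding v'_def z by (rule unitary_change_of_expansion(1)[OF unitary_upto_cnj[OF V] e, symmetric])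
    fix p q :: nat assume pq: "p < m" "q < m" "p \<noteq> q"
    have "cinner (blinfun_apply T (u' p)) (v' q) = bilinear_entry m N U V p q"
      unfolding u'_def v'_def blinfun_bounded_ops_sum[OF T] cinner_sum_left unfolding cinner_sum_right
      by (simp add: bilinear_entry_def N_def cinner_scaleC_left cinner_scaleC_right mult_ac)
    with diag[OF pq] show "cinner (blinfun_apply T (u' p)) (v' q) = 0"
      by simp
  qed
qed

section \<open>The distance estimate\<close>

text \<open>Along diagonalising expansions \<open>op_tensor t T B\<close> has only diagonal terms.
  The difference thus splits into the off-diagonal part of \<open>A\<close>, at most
  \<open>2 * b\<close>, and the diagonal terms \<open>d p\<close>, together at most
  \<open>(1 + norm T * norm g) * b\<close>.\<close>

lemma tensor_line_distance_unit:
  assumes T: "T \<in> bounded_ops" and A: "A \<in> bounded_ops" and B: "B \<in> bounded_ops" and b: "0 \<le> b"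
    and bound: "\<And>(I :: nat set) (J :: nat set) u f v f'. (\<forall>i\<in>I. \<forall>j\<in>J. cinner (blinfun_apply T (u i)) (v j) = 0) \<Longrightarrow>
      cmod (cinner (blinfun_apply A (\<Sum>i\<in>I. t (u i) (f i))) (\<Sum>j\<in>J. t (v j) (f' j)))
        \<le> b * (norm (\<Sum>i\<in>I. t (u i) (f i)) * norm (\<Sum>j\<in>J. t (v j) (f' j)))"
    and h: "norm h = 1" and hg: "cinner (blinfun_apply T h) g = 1"
    and coeff: "\<And>k k'. cinner (blinfun_apply B k) k' = cinner (blinfun_apply A (t h k)) (t g k')"
    and y: "y \<in> alg_tensor" "norm y = 1" and z: "z \<in> alg_tensor" "norm z = 1"
  shows "cmod (cinner (blinfun_apply (A - op_tensor t T B) y) z) \<le> (3 + norm T * norm g) * b"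
proof -
  obtain m f f' u v where f: "orthonormal_on {..<m::nat} f" and f': "orthonormal_on {..<m} f'"
    and y_eq: "y = (\<Sum>p<m. t (u p) (f p))" and z_eq: "z = (\<Sum>p<m. t (v p) (f' p))"
    and diag: "\<And>p q. p < m \<Longrightarrow> q < m \<Longrightarrow> p \<noteq> q \<Longrightarrow> cinner (blinfun_apply T (u p)) (v q) = 0"
    by (rule diagonalising_expansions[OF T y(1) z(1)]) (rule that)
  have on_subset: "orthonormal_on X e" if "orthonormal_on {..<m} e" "X \<subseteq> {..<m}" for X and e :: "nat \<Rightarrow> 'k"
    unfolding orthonormal_on_def using that(2) that(1)[unfolded orthonormal_on_def] by (intro ballI) (simp add: subset_iff)
  have sum_u: "(\<Sum>p<m. (norm (u p))\<^sup>2) = 1"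
    unfolding norm_orthonormal_sum[OF finite_lessThan f, symmetric] y_eq[symmetric] by (simp add: y(2))
  have sum_v: "(\<Sum>p<m. (norm (v p))\<^sup>2) = 1"
    unfolding norm_orthonormal_sum[OF finite_lessThan f', symmetric] z_eq[symmetric] by (simp add: z(2))
  define a where "a = (\<lambda>p q. cinner (blinfun_apply A (t (u p) (f p))) (t (v q) (f' q)))"
  define d where "d = (\<lambda>p. a p p - cinner (blinfun_apply T (u p)) (v p) * cinner (blinfun_apply A (t h (f p))) (t g (f' p)))"
  have "cmod (\<Sum>p<m. \<Sum>q\<in>{..<m} - {p}. a p q) \<le> b * ((\<Sum>p<m. (norm (u p))\<^sup>2) + (\<Sum>p<m. (norm (v p))\<^sup>2))"
  proof (rule off_diagonal_bound)
    fix X assume X: "X \<subseteq> {..<m}"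
    \<comment> \<open>Disjoint index sets make all \<open>T\<close>-coefficients between
      \<open>yX\<close> and \<open>zX\<close> vanish, so \<open>bound\<close> applies to the
      block.\<close>
    define yX zX where "yX = (\<Sum>p\<in>X. t (u p) (f p))" and "zX = (\<Sum>q\<in>{..<m} - X. t (v q) (f' q))"
    have "(\<Sum>p\<in>X. \<Sum>q\<in>{..<m} - X. a p q) = cinner (blinfun_apply A yX) zX"
      unfolding yX_def zX_def a_def blinfun.sum_right cinner_sum_left unfolding cinner_sum_right ..
    moreover have "cmod (cinner (blinfun_apply A yX) zX) \<le> b * (norm yX * norm zX)"
      unfolding yX_def zX_def by (rule bound) (use diag X in blast)
    moreover have "b * (norm yX * norm zX) \<le> b * (((norm yX)\<^sup>2 + (norm zX)\<^sup>2) / 2)"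
      using sum_squares_bound[of "norm yX" "norm zX"] b by (intro mult_left_mono) auto
    moreover have "(norm yX)\<^sup>2 = (\<Sum>p\<in>X. (norm (u p))\<^sup>2)" "(norm zX)\<^sup>2 = (\<Sum>q\<in>{..<m} - X. (norm (v q))\<^sup>2)"
      unfolding yX_def zX_def using finite_subset[OF X] on_subset[OF f X] on_subset[OF f']
      by (simp_all add: norm_orthonormal_sum)
    ultimately show "cmod (\<Sum>p\<in>X. \<Sum>q\<in>{..<m} - X. a p q)
        \<le> b * (((\<Sum>p\<in>X. (norm (u p))\<^sup>2) + (\<Sum>q\<in>{..<m} - X. (norm (v q))\<^sup>2)) / 2)"
      by simp
  qed simp
  then have off: "cmod (\<Sum>p<m. \<Sum>q\<in>{..<m} - {p}. a p q) \<le> 2 * b"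
    by (simp add: sum_u sum_v)
  \<comment> \<open>For fixed unit vectors \<open>f p\<close> and \<open>f' p\<close> this is a form
    on the first factor; \<open>bound\<close> for one-term sums is the hypothesis it must
    satisfy.\<close>
  have d_le: "cmod (d p) \<le> b * (1 + norm T * norm g) * (norm (u p) * norm (v p))" if "p < m" for p
    unfolding d_def a_def
  proof (rule linear_selection_bound[where a = "\<lambda>x x'. cinner (blinfun_apply A (t x (f p))) (t x' (f' p))"
        and \<tau> = "\<lambda>x x'. cinner (blinfun_apply T x) x'"])
    show "sesquilinear (\<lambda>x x'. cinner (blinfun_apply A (t x (f p))) (t x' (f' p)))"
      using A by (simp add: sesquilinear_def tensor_add_left tensor_scaleC_left blinfun.add_right
          bounded_ops_def cinner_simps)
    show "sesquilinear (\<lambda>x x'. cinner (blinfun_apply T x) x')"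
      using T by (simp add: sesquilinear_def blinfun.add_right bounded_ops_def cinner_simps)
    have "norm (f p) = 1" "norm (f' p) = 1"
      using norm_orthonormal_on[OF f] norm_orthonormal_on[OF f'] that by simp_all
    then show "cmod (cinner (blinfun_apply A (t x (f p))) (t x' (f' p))) \<le> b * (norm x * norm x')"
      if "cinner (blinfun_apply T x) x' = 0" for x x'
      using bound[of "{0}" "{0}" "\<lambda>_. x" "\<lambda>_. x'" "\<lambda>_. f p" "\<lambda>_. f' p"] that by (simp add: norm_tensor)
    show "cmod (cinner (blinfun_apply T x) x') \<le> norm T * (norm x * norm x')" for x x'
      using cinner_Cauchy_Schwarz[of "blinfun_apply T x" x'] norm_blinfun[of T x]
        mult_right_mono[of "norm (blinfun_apply T x)" "norm T * norm x" "norm x'"]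
      by (simp add: mult.assoc)
  qed (use b h hg in auto)
  have "(\<Sum>p<m. norm (u p) * norm (v p)) \<le> (\<Sum>p<m. ((norm (u p))\<^sup>2 + (norm (v p))\<^sup>2) / 2)"
  proof (rule sum_mono)
    show "norm (u p) * norm (v p) \<le> ((norm (u p))\<^sup>2 + (norm (v p))\<^sup>2) / 2" for p
      using sum_squares_bound[of "norm (u p)" "norm (v p)"] by simp
  qed
  also have "\<dots> = 1"
    by (simp add: sum.distrib sum_u sum_v flip: sum_divide_distrib)
  finally have uv: "(\<Sum>p<m. norm (u p) * norm (v p)) \<le> 1" .
  have "cmod (\<Sum>p<m. d p) \<le> (\<Sum>p<m. b * (1 + norm T * norm g) * (norm (u p) * norm (v p)))"
    using d_le by (intro sum_norm_le) auto
  also have "\<dots> = b * (1 + norm T * norm g) * (\<Sum>p<m. norm (u p) * norm (v p))"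
    by (simp add: sum_distrib_left)
  also have "\<dots> \<le> b * (1 + norm T * norm g)"
    using mult_left_mono[OF uv, of "b * (1 + norm T * norm g)"] b by simp
  finally have on: "cmod (\<Sum>p<m. d p) \<le> b * (1 + norm T * norm g)" .
  have split: "(\<Sum>q<m. x q) = x p + (\<Sum>q\<in>{..<m} - {p}. x q)" if "p < m" for p and x :: "nat \<Rightarrow> complex"
    using that by (intro sum.remove) auto
  have "cinner (blinfun_apply A y) z = (\<Sum>p<m. a p p + (\<Sum>q\<in>{..<m} - {p}. a p q))"
    unfolding y_eq z_eq blinfun.sum_right cinner_sum_left unfolding cinner_sum_right
    unfolding a_def by (rule sum.cong[OF refl], rule split) simp
  \<comment> \<open>Diagonality removes the terms with \<open>p \<noteq> q\<close>, and
    \<open>coeff\<close> rewrites the coefficients of \<open>B\<close> through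
    \<open>A\<close>.\<close>
  moreover have "cinner (blinfun_apply (op_tensor t T B) y) z
      = (\<Sum>p<m. cinner (blinfun_apply T (u p)) (v p) * cinner (blinfun_apply A (t h (f p))) (t g (f' p)))"
  proof -
    have "cinner (blinfun_apply (op_tensor t T B) y) z
        = (\<Sum>p<m. \<Sum>q<m. cinner (blinfun_apply T (u p)) (v q) * cinner (blinfun_apply B (f p)) (f' q))"
      unfolding y_eq z_eq blinfun.sum_right cinner_sum_left unfolding cinner_sum_right
      by (simp add: op_tensor[OF T B] cinner_tensor)
    also have "\<dots> = (\<Sum>p<m. cinner (blinfun_apply T (u p)) (v p) * cinner (blinfun_apply B (f p)) (f' p))"
    proof (rule sum.cong[OF refl])
      fix p assume "p \<in> {..<m}"
      then have p: "p < m"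
        by simp
      show "(\<Sum>q<m. cinner (blinfun_apply T (u p)) (v q) * cinner (blinfun_apply B (f p)) (f' q))
          = cinner (blinfun_apply T (u p)) (v p) * cinner (blinfun_apply B (f p)) (f' p)"
        unfolding split[OF p] using diag[OF p] by (simp add: sum.neutral)
    qed
    finally show ?thesis
      by (simp add: coeff)
  qed
  ultimately have "cinner (blinfun_apply (A - op_tensor t T B) y) z
      = (\<Sum>p<m. d p) + (\<Sum>p<m. \<Sum>q\<in>{..<m} - {p}. a p q)"
    by (simp add: blinfun.diff_left cinner_diff_left d_def sum.distrib sum_subtractf)
  then have "cmod (cinner (blinfun_apply (A - op_tensor t T B) y) z) \<le> b * (1 + norm T * norm g) + 2 * b"
    using norm_triangle_ineq[of "\<Sum>p<m. d p" "\<Sum>p<m. \<Sum>q\<in>{..<m} - {p}. a p q"] on off by simp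
  then show ?thesis
    by (simp add: algebra_simps)
qed

text \<open>Density is used twice: first to allow \<open>z = C y\<close> for algebraic
  \<open>y\<close>, then to pass to all \<open>y\<close>.\<close>

lemma norm_le_of_alg_tensor_unit:
  assumes C: "C \<in> bounded_ops" and c: "0 \<le> c"
    and unit: "\<And>y z. y \<in> alg_tensor \<Longrightarrow> norm y = 1 \<Longrightarrow> z \<in> alg_tensor \<Longrightarrow> norm z = 1 \<Longrightarrow>
      cmod (cinner (blinfun_apply C y) z) \<le> c"
  shows "norm C \<le> c"
proof -
  have alg: "cmod (cinner (blinfun_apply C y) z) \<le> c * norm y * norm z"
    if yz: "y \<in> alg_tensor" "z \<in> alg_tensor" for y z
  proof (cases "y = 0 \<or> z = 0")
    case False
    define y' z' where "y' = complex_of_real (inverse (norm y)) *\<^sub>C y"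
      and "z' = complex_of_real (inverse (norm z)) *\<^sub>C z"
    have "cmod (cinner (blinfun_apply C y') z') \<le> c"
      using yz False subspace_alg_tensor
      by (intro unit) (simp_all add: y'_def z'_def norm_scaleC norm_inverse complex_vector.subspace_scale)
    moreover have "cmod (cinner (blinfun_apply C y') z')
        = inverse (norm y) * (inverse (norm z) * cmod (cinner (blinfun_apply C y) z))"
      using C by (simp add: y'_def z'_def bounded_ops_def cinner_scaleC_left cinner_scaleC_right
          norm_mult norm_inverse)
    ultimately show ?thesis
      using False by (simp add: field_simps)
  qed auto
  have alg': "norm (blinfun_apply C y) \<le> c * norm y" if "y \<in> alg_tensor" for y
  proof -
    have "alg_tensor \<subseteq> {z. cmod (cinner (blinfun_apply C y) z) \<le> c * norm y * norm z}"
      using alg[OF that] by blast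
    moreover have "closed {z. cmod (cinner (blinfun_apply C y) z) \<le> c * norm y * norm z}"
      by (intro closed_Collect_le continuous_intros)
    ultimately have "cmod (cinner (blinfun_apply C y) (blinfun_apply C y)) \<le> c * norm y * norm (blinfun_apply C y)"
      using closed_superset_alg_tensor by blast
    then have "norm (blinfun_apply C y) * norm (blinfun_apply C y) \<le> c * norm y * norm (blinfun_apply C y)"
      by (simp add: cinner_self norm_power power2_eq_square norm_mult)
    then show ?thesis
      using c by (cases "blinfun_apply C y = 0") auto
  qed
  have "closed {y. norm (blinfun_apply C y) \<le> c * norm y}"
    by (intro closed_Collect_le continuous_intros)
  then have "norm (blinfun_apply C y) \<le> c * norm y" for y
    using closed_superset_alg_tensor[of "{y. norm (blinfun_apply C y) \<le> c * norm y}"] alg' by blast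
  then show ?thesis
    using c by (intro norm_blinfun_bound)
qed

text \<open>\<open>B\<close> is the composition of \<open>t h\<close>, \<open>A\<close> and the
  adjoint \<open>J\<close> of \<open>t g\<close>.\<close>

lemma slice_operator_exists:
  assumes "A \<in> bounded_ops"
  obtains B where "B \<in> bounded_ops"
    "\<And>k k'. cinner (blinfun_apply B k) k' = cinner (blinfun_apply A (t h k)) (t g k')"
proof -
  have lin: "bounded_linear (t x)" for x
    by (rule bounded_linear_intro[where K = "norm x"])
      (simp_all add: tensor_add_right tensor_scaleC_right scaleR_scaleC norm_tensor mult.commute)
  obtain J where J: "bounded_linear J" "\<And>c w. J (c *\<^sub>C w) = c *\<^sub>C J w"
    "\<And>k w. cinner (J w) k = cinner w (t g k)"
    by (rule adjoint_exists[OF lin tensor_scaleC_right]) (rule that)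
  define F where "F = (\<lambda>k. J (blinfun_apply A (t h k)))"
  have "bounded_linear F"
    unfolding F_def
    by (intro bounded_linear_compose[OF J(1)] bounded_linear_compose[OF blinfun.bounded_linear_right] lin)
  then have "blinfun_apply (Blinfun F) = F"
    by (rule bounded_linear_Blinfun_apply)
  moreover have "F (c *\<^sub>C k) = c *\<^sub>C F k" for c k
    using assms by (simp add: F_def tensor_scaleC_right bounded_ops_def J(2))
  ultimately show ?thesis
    by (intro that[of "Blinfun F"]) (simp_all add: bounded_ops_def F_def J(3))
qed

text \<open>The equations say that \<open>C\<close> is \<open>T\<close> tensor its slice. They hold
  for the generators and survive both closures; conversely, a solution is itself a
  generator.\<close>

lemma wot_tensor_line:
  assumes T: "T \<in> bounded_ops" and hg: "cinner (blinfun_apply T h) g = 1"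
  shows "wot_tensor t (range (\<lambda>c. c *\<^sub>C T)) bounded_ops =
    {C \<in> bounded_ops. \<forall>i\<in>UNIV. case i of (x, x', k, k') \<Rightarrow> cinner (blinfun_apply C (t x k)) (t x' k')
      = cinner (blinfun_apply T x) x' * cinner (blinfun_apply C (t h k)) (t g k')}" (is "?S = ?R")
proof -
  let ?gen = "{op_tensor t A B | A B. A \<in> range (\<lambda>c. c *\<^sub>C T) \<and> B \<in> bounded_ops}"
  \<comment> \<open>The equations are put in the indexed form of the lemmas on coefficient
    sets.\<close>
  let ?u = "\<lambda>(x, x', k, k'). t x k" and ?v = "\<lambda>(x, x', k, k'). t x' k'"
  let ?c = "\<lambda>(x, x', k, k'). cinner (blinfun_apply T x) x'"
  let ?u' = "\<lambda>(x, x', k, k'). t h k" and ?v' = "\<lambda>(x, x', k, k'). t g k'"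
  have R: "?R = {C \<in> bounded_ops. \<forall>i\<in>UNIV. cinner (blinfun_apply C (?u i)) (?v i)
      = ?c i * cinner (blinfun_apply C (?u' i)) (?v' i)}"
    by auto
  have "?gen \<subseteq> ?R"
  proof
    fix C assume "C \<in> ?gen"
    then obtain c B where C: "C = op_tensor t (c *\<^sub>C T) B" and B: "B \<in> bounded_ops"
      by blast
    have cT: "c *\<^sub>C T \<in> bounded_ops"
      using T subspace_bounded_ops complex_vector.subspace_scale by blast
    show "C \<in> ?R"
      using hg by (auto simp: C op_tensor[OF cT B] cinner_tensor cinner_scaleC_left)
  qed
  then have "complex_vector.span ?gen \<subseteq> ?R"
    unfolding R by (rule complex_vector.span_minimal) (rule subspace_coefficients)
  then have "spatial_tensor t (range (\<lambda>c. c *\<^sub>C T)) bounded_ops \<subseteq> ?R"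
    unfolding spatial_tensor_def R by (rule closure_minimal) (rule closed_coefficients)
  then have "?S \<subseteq> ?R"
    unfolding wot_tensor_def R
    by (rule closure_of_minimal) (rule closedin_weak_operator_topology_coefficients)
  moreover have "?R \<subseteq> ?S"
  proof
    fix C assume C: "C \<in> ?R"
    then have C_ops: "C \<in> bounded_ops"
      by blast
    obtain B where B: "B \<in> bounded_ops"
      and coeff: "\<And>k k'. cinner (blinfun_apply B k) k' = cinner (blinfun_apply C (t h k)) (t g k')"
      by (rule slice_operator_exists[OF C_ops]) (rule that)
    have rel: "cinner (blinfun_apply C (t x k)) (t x' k')
        = cinner (blinfun_apply T x) x' * cinner (blinfun_apply C (t h k)) (t g k')" for x x' k k'
      using C by blast
    have "blinfun_apply C (t x k) = t (blinfun_apply T x) (blinfun_apply B k)" for x k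
      by (rule tensor_total, unfold cinner_tensor coeff, rule rel)
    then have "C = op_tensor t T B"
      using op_tensor_equality[OF C_ops] by simp
    then have "C \<in> ?gen"
      using B by (auto intro!: exI[of _ T] range_eqI[of _ _ 1] simp: scaleC_one)
    then have "C \<in> spatial_tensor t (range (\<lambda>c. c *\<^sub>C T)) bounded_ops"
      unfolding spatial_tensor_def by (intro subsetD[OF closure_subset] complex_vector.span_base)
    with C_ops show "C \<in> ?S"
      unfolding wot_tensor_def by (intro subsetD[OF closure_of_subset_Int]) simp
  qed
  ultimately show ?thesis
    by blast
qed

text \<open>The operator \<open>T\<close> tensor the slice of \<open>A\<close> lies in
  \<open>S\<close>, so its distance from \<open>A\<close> bounds \<open>infdist A S\<close>.\<close>

lemma infdist_wot_tensor_line: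
  assumes T: "T \<in> bounded_ops" and A: "A \<in> bounded_ops" and h: "norm h = 1" and Th: "blinfun_apply T h \<noteq> 0"
    and k: "(k :: 'k) \<noteq> 0"
  defines "S \<equiv> wot_tensor t (range (\<lambda>c. c *\<^sub>C T)) bounded_ops"
  shows "0 \<le> hyperreflexivity_beta S A"
    and "infdist A S \<le> (3 + norm T / norm (blinfun_apply T h)) * hyperreflexivity_beta S A"
proof -
  define b where "b = hyperreflexivity_beta S A"
  \<comment> \<open>This multiple of \<open>T h\<close> gives \<open>cinner (T h) g = 1\<close> with
    \<open>norm g = 1 / norm (T h)\<close>, which turns \<open>norm T * norm g\<close> into the
    stated ratio.\<close>
  define g where "g = complex_of_real (inverse ((norm (blinfun_apply T h))\<^sup>2)) *\<^sub>C blinfun_apply T h"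
  have hg: "cinner (blinfun_apply T h) g = 1"
    using Th by (simp add: g_def cinner_scaleC_right cinner_self)
  have norm_g: "norm g = inverse (norm (blinfun_apply T h))"
    using Th by (simp add: g_def norm_scaleC norm_inverse norm_mult power2_eq_square)
  note S = wot_tensor_line[OF T hg, folded S_def]
  have S_sub: "complex_vector.subspace S"
  proof -
    have "S = {C \<in> bounded_ops. \<forall>i\<in>UNIV.
        cinner (blinfun_apply C ((\<lambda>(x, x', k, k'). t x k) i)) ((\<lambda>(x, x', k, k'). t x' k') i)
        = (\<lambda>(x, x', k, k'). cinner (blinfun_apply T x) x') i
          * cinner (blinfun_apply C ((\<lambda>(x, x', k, k'). t h k) i)) ((\<lambda>(x, x', k, k'). t g k') i)}"
      unfolding S by auto
    then show ?thesis
      by (simp only: subspace_coefficients)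
  qed
  have S_ops: "S \<subseteq> bounded_ops"
    unfolding S by blast
  \<comment> \<open>A unit vector: its residual is a nonnegative lower bound for \<beta>.\<close>
  define e where "e = t h (complex_of_real (inverse (norm k)) *\<^sub>C k)"
  have "norm e = 1"
    using k h by (simp add: e_def norm_tensor norm_scaleC norm_inverse)
  from order_trans[OF norm_ge_zero norm_residual_le_hyperreflexivity_beta[OF S_sub this]]
  show b0: "0 \<le> hyperreflexivity_beta S A" .
  have bound: "cmod (cinner (blinfun_apply A (\<Sum>i\<in>I. t (u i) (f i))) (\<Sum>j\<in>J. t (v j) (f' j)))
      \<le> b * (norm (\<Sum>i\<in>I. t (u i) (f i)) * norm (\<Sum>j\<in>J. t (v j) (f' j)))"
    if orth: "\<forall>i\<in>I. \<forall>j\<in>J. cinner (blinfun_apply T (u i)) (v j) = 0" for I J :: "nat set" and u f v f'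
    unfolding b_def
  proof (rule cmod_cinner_le_hyperreflexivity_beta[OF S_sub S_ops A])
    fix C assume C: "C \<in> S"
    have "cinner (blinfun_apply C (t x k)) (t x' k')
        = cinner (blinfun_apply T x) x' * cinner (blinfun_apply C (t h k)) (t g k')" for x x' k k'
      using C[unfolded S] by blast
    from this[of "u _" _ "v _"]
    have "cinner (blinfun_apply C (t (u i) (f i))) (t (v j) (f' j)) = 0" if "i \<in> I" "j \<in> J" for i j
      using orth that by (metis mult_zero_left)
    then show "cinner (blinfun_apply C (\<Sum>i\<in>I. t (u i) (f i))) (\<Sum>j\<in>J. t (v j) (f' j)) = 0"
      unfolding blinfun.sum_right cinner_sum_left unfolding cinner_sum_right by (intro sum.neutral ballI)
  qed
  obtain B where B: "B \<in> bounded_ops"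
    and coeff: "\<And>k k'. cinner (blinfun_apply B k) k' = cinner (blinfun_apply A (t h k)) (t g k')"
    by (rule slice_operator_exists[OF A]) (rule that)
  have b_nonneg: "0 \<le> b"
    using b0 by (simp add: b_def)
  have "norm (A - op_tensor t T B) \<le> (3 + norm T * norm g) * b"
  proof (rule norm_le_of_alg_tensor_unit)
    show "A - op_tensor t T B \<in> bounded_ops"
      using A op_tensor(1)[OF T B] subspace_bounded_ops complex_vector.subspace_diff by blast
    show "0 \<le> (3 + norm T * norm g) * b"
      using b_nonneg by simp
    show "cmod (cinner (blinfun_apply (A - op_tensor t T B) y) z) \<le> (3 + norm T * norm g) * b"
      if "y \<in> alg_tensor" "norm y = 1" "z \<in> alg_tensor" "norm z = 1" for y z
      by (rule tensor_line_distance_unit[OF T A B b_nonneg bound h hg coeff that])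
  qed
  moreover have "op_tensor t T B \<in> S"
    unfolding S using hg by (auto simp: op_tensor[OF T B] cinner_tensor)
  ultimately show "infdist A S \<le> (3 + norm T / norm (blinfun_apply T h)) * hyperreflexivity_beta S A"
    using infdist_le[of "op_tensor t T B" S A] by (simp add: b_def norm_g dist_norm divide_inverse)
qed

end

section \<open>Passage to the constant 4\<close>

text \<open>The norm need not be attained, hence the factor \<open>1 + \<epsilon>\<close>; without
  such a vector, \<open>norm T / (1 + \<epsilon>)\<close> would be a smaller bound for
  \<open>T\<close>.\<close>

lemma almost_norm_attaining_vector:
  fixes T :: "'h::chilbert_space \<Rightarrow>\<^sub>L 'h"
  assumes T: "T \<in> bounded_ops" "T \<noteq> 0" and \<epsilon>: "0 < \<epsilon>"
  obtains h where "norm h = 1" "blinfun_apply T h \<noteq> 0" "norm T / norm (blinfun_apply T h) \<le> 1 + \<epsilon>"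
proof -
  have "norm T / (1 + \<epsilon>) < norm T"
    using T(2) \<epsilon> by (simp add: divide_less_eq)
  moreover have "norm T \<le> norm T / (1 + \<epsilon>)"
    if "\<forall>x. norm (blinfun_apply T x) \<le> norm T / (1 + \<epsilon>) * norm x"
    using that \<epsilon> by (intro norm_blinfun_bound) auto
  ultimately obtain x where x: "norm T / (1 + \<epsilon>) * norm x < norm (blinfun_apply T x)"
    by (meson leD not_le)
  then have "x \<noteq> 0"
    by auto
  define h where "h = complex_of_real (inverse (norm x)) *\<^sub>C x"
  have "norm h = 1"
    using \<open>x \<noteq> 0\<close> by (simp add: h_def norm_scaleC norm_inverse)
  moreover have "norm (blinfun_apply T h) = norm (blinfun_apply T x) / norm x"
    using T(1) by (simp add: h_def bounded_ops_def norm_scaleC norm_inverse divide_inverse)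
  then have "norm T / (1 + \<epsilon>) < norm (blinfun_apply T h)"
    using x \<open>x \<noteq> 0\<close> by (simp add: pos_less_divide_eq)
  moreover from this have "0 < norm (blinfun_apply T h)"
    using \<epsilon> by (meson divide_nonneg_pos le_less_trans norm_ge_zero add_pos_pos zero_less_one)
  ultimately show ?thesis
    using \<epsilon> by (intro that[of h]) (auto simp: field_simps)
qed

lemma line_subspace: "complex_vector.subspace (range (\<lambda>c. c *\<^sub>C x))"
  by (metis complex_vector.span_singleton complex_vector.subspace_span)

text \<open>The line consists of the operators \<open>A\<close> whose coefficients are those of
  \<open>T\<close> times the scalar \<open>cinner (A h) g\<close>, a family of weakly closed
  conditions.\<close>

lemma closedin_weak_operator_topology_line:
  assumes T: "T \<in> bounded_ops" "T \<noteq> 0"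
  shows "closedin weak_operator_topology (range (\<lambda>c. c *\<^sub>C T))"
proof -
  obtain h where h: "blinfun_apply T h \<noteq> 0"
    using T(2) by (metis blinfun_eqI zero_blinfun.rep_eq)
  define g where "g = complex_of_real (inverse ((norm (blinfun_apply T h))\<^sup>2)) *\<^sub>C blinfun_apply T h"
  have hg: "cinner (blinfun_apply T h) g = 1"
    using h by (simp add: g_def cinner_scaleC_right cinner_self)
  let ?R = "{A \<in> bounded_ops. \<forall>i\<in>UNIV. cinner (blinfun_apply A (fst i)) (snd i)
      = cinner (blinfun_apply T (fst i)) (snd i) * cinner (blinfun_apply A h) g}"
  have "A \<in> range (\<lambda>c. c *\<^sub>C T)" if "A \<in> ?R" for A
  proof -
    have rel: "cinner (blinfun_apply A x) z = cinner (blinfun_apply T x) z * cinner (blinfun_apply A h) g" for x z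
      using that[THEN CollectD, THEN conjunct2, THEN bspec, of "(x, z)"] by (simp only: fst_conv snd_conv UNIV_I)
    have "blinfun_apply A x = blinfun_apply (cinner (blinfun_apply A h) g *\<^sub>C T) x" for x
      by (rule cinner_eq_imp_eq, unfold blinfun_apply_scaleC cinner_scaleC_left,
          subst mult.commute, rule rel)
    then have "A = cinner (blinfun_apply A h) g *\<^sub>C T"
      by (rule blinfun_eqI)
    then show ?thesis
      by blast
  qed
  moreover have "c *\<^sub>C T \<in> ?R" for c
    using T(1) subspace_bounded_ops complex_vector.subspace_scale hg
    by (auto simp: cinner_scaleC_left)
  ultimately have "range (\<lambda>c. c *\<^sub>C T) = ?R"
    by blast
  then show ?thesis
    using closedin_weak_operator_topology_coefficients[of UNIV fst snd
        "\<lambda>i. cinner (blinfun_apply T (fst i)) (snd i)" "\<lambda>_. h" "\<lambda>_. g"] by simp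
qed

theorem theorem6p15:
  fixes t :: "'h::chilbert_space \<Rightarrow> 'k::chilbert_space \<Rightarrow> 'l::chilbert_space"
    and T :: "'h \<Rightarrow>\<^sub>L 'h"
  assumes "separable_space (euclidean :: 'k topology)"
    and "\<not> (\<exists>B :: 'k set. finite B \<and> complex_vector.span B = UNIV)"
    and "is_hilbert_tensor t"
    and "T \<in> bounded_ops"
    and "T \<noteq> 0"
  shows "completely_hyperreflexive t (range (\<lambda>c. c *\<^sub>C T)) \<and>
    complete_hyperreflexivity_constant t (range (\<lambda>c. c *\<^sub>C T)) \<le> 4"
proof -
  interpret hilbert_tensor t
    by unfold_locales (rule assms(3))
  let ?S = "wot_tensor t (range (\<lambda>c. c *\<^sub>C T)) bounded_ops"
  \<comment> \<open>Infinite dimension supplies a nonzero vector of the second factor: the empty set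
    does not span.\<close>
  have "complex_vector.span ({} :: 'k set) \<noteq> UNIV"
    using assms(2) by (metis finite.emptyI)
  then have "UNIV \<noteq> {0 :: 'k}"
    by (simp only: complex_vector.span_empty not_sym)
  then obtain k :: 'k where k: "k \<noteq> 0"
    by blast
  have "infdist A ?S \<le> 4 * hyperreflexivity_beta ?S A" if A: "A \<in> bounded_ops" for A
  proof (rule field_le_epsilon)
    fix \<epsilon> :: real assume \<epsilon>: "0 < \<epsilon>"
    let ?b = "hyperreflexivity_beta ?S A"
    obtain h\<^sub>0 where h\<^sub>0: "norm h\<^sub>0 = 1" "blinfun_apply T h\<^sub>0 \<noteq> 0"
      by (rule almost_norm_attaining_vector[OF assms(4,5) zero_less_one])
    \<comment> \<open>Nonnegativity of \<beta> is needed before the tolerance for the final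
      \<open>h\<close> can be chosen.\<close>
    have b: "0 \<le> ?b"
      by (rule infdist_wot_tensor_line(1)[OF assms(4) A h\<^sub>0 k])
    \<comment> \<open>The summand 1 keeps the divisor positive when \<beta> vanishes, and the
      resulting error is still at most \<epsilon>.\<close>
    then have "0 < \<epsilon> / (?b + 1)"
      using \<epsilon> by simp
    then obtain h where h: "norm h = 1" "blinfun_apply T h \<noteq> 0"
      "norm T / norm (blinfun_apply T h) \<le> 1 + \<epsilon> / (?b + 1)"
      by (rule almost_norm_attaining_vector[OF assms(4,5)])
    have "infdist A ?S \<le> (3 + norm T / norm (blinfun_apply T h)) * ?b"
      by (rule infdist_wot_tensor_line(2)[OF assms(4) A h(1,2) k])
    also have "\<dots> \<le> (4 + \<epsilon> / (?b + 1)) * ?b"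
      using h(3) b by (intro mult_right_mono) auto
    also have "\<dots> \<le> 4 * ?b + \<epsilon>"
      using b \<epsilon> by (simp add: field_simps)
    finally show "infdist A ?S \<le> 4 * ?b + \<epsilon>" .
  qed
  then have bound: "hyperreflexivity_bound ?S 4"
    by (simp add: hyperreflexivity_bound_def)
  then have "completely_hyperreflexive t (range (\<lambda>c. c *\<^sub>C T))"
    using line_subspace closedin_weak_operator_topology_line[OF assms(4,5)]
    unfolding completely_hyperreflexive_def hyperreflexive_def by blast
  moreover have "hyperreflexivity_constant ?S \<le> 4"
    unfolding hyperreflexivity_constant_def
    by (rule cInf_lower) (use bound in \<open>auto intro!: bdd_belowI[of _ 1]\<close>)
  ultimately show ?thesis
    by (simp add: complete_hyperreflexivity_constant_def)
qed

end
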